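(* For any integer $p\ge 1$ consider the ideal $$I_p=\langle\, x-(z+1)^{p+2},\; y-(z-1)^p\,\rangle\subset\mathbb{C}[x,y,z].$$ Then the tropical variety $\mathcal{T}(I_p)\subset\mathbb{R}^3$ consists of $4$ rays, but the Gröbner fan of $I_p$ has at least $\frac14(p+1)$ rays.
   Context: For $f\in\mathbb{C}[x_1,\ldots,x_n]$ and $w\in\mathbb{R}^n$, the initial form $\mathrm{in}_w(f)$ is the sum of all terms $c\,x^u$ of $f$ of lowest $w$-weight $w\cdot u$ (and $\mathrm{in}_w(0)=0$). A monomial here means a single term, up to a nonzero scalar. For an ideal $I$, $\mathrm{in}_w(I)=\langle \mathrm{in}_w(f):f\in I\rangle$, and the tropical variety is $\mathcal{T}(I)=\{w\in\mathbb{R}^n:\mathrm{in}_w(I)\text{ contains no monomial}\}$. For a homogeneous ideal $I$, the Gröbner fan is the complete finite rational polyhedral fan in $\mathbb{R}^n$ whose cones are the closures of the classes $\{w':\mathrm{in}_{w'}(I)=\mathrm{in}_w(I)\}$. For a non-homogeneous ideal $I\subset\mathbb{C}[x_1,\ldots,x_n]$ with homogenization ${}^hI\subset\mathbb{C}[x_0,x_1,\ldots,x_n]$ (generated by the homogenizations of all $f\in I$), the Gröbner fan of $I$ in $\mathbb{R}^n$ is the fan of all sets $\{w:(0,w)\in C\}$ for $C$ a cone of the Gröbner fan of ${}^hI$. A ray of a fan is a one-dimensional cone (half-line from the origin) of the fan; here $\mathcal{T}(I_p)$ consists of rays together with the origin. *)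

theory Defs
  imports "HOL-Analysis.Analysis" "HOL-Library.Poly_Mapping"
begin

text \<open>Polynomials over the complex numbers in variables indexed by \<open>'v\<close>, as finitely supported
  maps from exponent vectors to coefficients; the ring structure is the convolution ring of
  \<^theory>\<open>HOL-Library.Poly_Mapping\<close>.\<close>

type_synonym 'v expo = "'v \<Rightarrow>\<^sub>0 nat"
type_synonym 'v cpoly = "'v expo \<Rightarrow>\<^sub>0 complex"

definition Var :: "'v \<Rightarrow> 'v cpoly" where
  "Var i = Poly_Mapping.single (Poly_Mapping.single i 1) 1"

definition ideal_generated :: "'a::comm_ring_1 set \<Rightarrow> 'a set" where
  "ideal_generated S = module.span (*) S"

lemma module_times: "module ((*) :: 'a::comm_ring_1 \<Rightarrow> 'a \<Rightarrow> 'a)"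
  by unfold_locales (simp_all add: algebra_simps)


subsection \<open>Initial ideals and tropical varieties\<close>

definition weight :: "real ^ 'v::finite \<Rightarrow> 'v expo \<Rightarrow> real" where
  "weight w u = (\<Sum>i\<in>UNIV. w $ i * real (Poly_Mapping.lookup u i))"

definition initial_form :: "real ^ 'v::finite \<Rightarrow> 'v cpoly \<Rightarrow> 'v cpoly" where
  "initial_form w f =
    (\<Sum>u \<in> {u \<in> Poly_Mapping.keys f. \<forall>v \<in> Poly_Mapping.keys f. weight w u \<le> weight w v}.
       Poly_Mapping.single u (Poly_Mapping.lookup f u))"

definition initial_ideal :: "real ^ 'v::finite \<Rightarrow> 'v cpoly set \<Rightarrow> 'v cpoly set" where
  "initial_ideal w I = ideal_generated (initial_form w ` I)"

definition is_monomial :: "'v cpoly \<Rightarrow> bool" where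
  "is_monomial m \<longleftrightarrow> (\<exists>u c. c \<noteq> 0 \<and> m = Poly_Mapping.single u c)"

definition tropical_variety :: "'v::finite cpoly set \<Rightarrow> (real ^ 'v) set" where
  "tropical_variety I = {w. \<not> (\<exists>m \<in> initial_ideal w I. is_monomial m)}"


subsection \<open>Homogenization\<close>

text \<open>The homogenizing variable is indexed by \<open>None\<close>, the original variables by \<open>Some i\<close>.\<close>

definition expo_degree :: "'v::finite expo \<Rightarrow> nat" where
  "expo_degree u = (\<Sum>i\<in>UNIV. Poly_Mapping.lookup u i)"

text \<open>The value of \<open>total_degree\<close> at the zero polynomial is a dummy, which does not affect
  \<open>homogenize 0 = 0\<close>.\<close>

definition total_degree :: "'v::finite cpoly \<Rightarrow> nat" where
  "total_degree f = Max (insert 0 (expo_degree ` Poly_Mapping.keys f))"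

definition homogenize_expo :: "nat \<Rightarrow> 'v::finite expo \<Rightarrow> 'v option expo" where
  "homogenize_expo d u = Poly_Mapping.single None (d - expo_degree u) +
     (\<Sum>i\<in>UNIV. Poly_Mapping.single (Some i) (Poly_Mapping.lookup u i))"

definition homogenize :: "'v::finite cpoly \<Rightarrow> 'v option cpoly" where
  "homogenize f = (\<Sum>u \<in> Poly_Mapping.keys f.
     Poly_Mapping.single (homogenize_expo (total_degree f) u) (Poly_Mapping.lookup f u))"

definition homogenize_ideal :: "'v::finite cpoly set \<Rightarrow> 'v option cpoly set" where
  "homogenize_ideal I = ideal_generated (homogenize ` I)"


subsection \<open>Groebner fans\<close>

text \<open>A fan is represented by the set of its cones. The following is the Groebner fan only for
  homogeneous ideals; it is used for homogenized ideals.\<close>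

definition groebner_fan_homogeneous :: "'v::finite cpoly set \<Rightarrow> (real ^ 'v) set set" where
  "groebner_fan_homogeneous J =
     {closure {w'. initial_ideal w' J = initial_ideal w J} | w. True}"

text \<open>The weight vector \<open>(0, w)\<close>.\<close>

definition lift_weight :: "real ^ 'v::finite \<Rightarrow> real ^ 'v option" where
  "lift_weight w = (\<chi> j. case j of None \<Rightarrow> 0 | Some i \<Rightarrow> w $ i)"

definition groebner_fan :: "'v::finite cpoly set \<Rightarrow> (real ^ 'v) set set" where
  "groebner_fan I =
     {{w. lift_weight w \<in> C} | C. C \<in> groebner_fan_homogeneous (homogenize_ideal I)}"

definition is_ray :: "'a::real_vector set \<Rightarrow> bool" where
  "is_ray R \<longleftrightarrow> (\<exists>v. v \<noteq> 0 \<and> R = {t *\<^sub>R v | t. t \<ge> 0})"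


subsection \<open>The ideals \<open>I\<^sub>p\<close>\<close>

text \<open>The variables \<open>x, y, z\<close> are indexed by \<open>1, 2, 3 :: 3\<close>, which are the three distinct elements
  of this type (in it, \<open>3 = 0\<close>).\<close>

definition curve_ideal :: "nat \<Rightarrow> 3 cpoly set" where
  "curve_ideal p = (let x = Var 1; y = Var 2; z = Var 3 in
     ideal_generated {x - (z + 1) ^ (p + 2), y - (z - 1) ^ p})"

end

(* The curve is parametrized by t |-> ((t+1)^(p+2), (t-1)^p, t), so an element of I_p with a single
   term of lowest weight gives a linear relation between a monomial and the monomials of larger weight
   after substitution. On the rays e_1, e_2, e_3 and -(p+2, p, 1) such a relation is impossible by the
   orders of vanishing at t = -1, 1, 0 and infinity; the other weights are excluded by the initial forms
   of the two generators.

   For the Groebner fan, consider the Pade relations A(t) (t+1)^(p+2) + B(t) (t-1)^p + C(t) = 0 with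
   deg A = i, deg B = i+2, deg C = p-1-i. Then A x + B y + C lies in I_p and for the weight
   -(p-1-2i, p-3-2i, 1) has an initial form with three terms. As relations of smaller degrees do not
   exist (they would not survive differentiating C away), none of these terms is in the initial
   ideal as long as 3i+5 <= p (then monomials of degree at least two in x, y do not interfere). Any
   weight with the same initial ideal has to give these three terms equal weight, which leaves a line.
   This gives about p/3 rays; together with two rays of the tropical variety they suffice for all p. *)

theory Submission
  imports Defs "HOL-Computational_Algebra.Polynomial"
begin

subsection \<open>Initial forms\<close>

abbreviation lookup where "lookup \<equiv> Poly_Mapping.lookup"
abbreviation keys where "keys \<equiv> Poly_Mapping.keys"

lemma expansion_singles:
  assumes "finite A" "keys f \<subseteq> A"
  shows "f = (\<Sum>u\<in>A. Poly_Mapping.single u (lookup f u))"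
  using assms by (intro poly_mapping_eqI)
    (auto simp: lookup_sum lookup_single when_def in_keys_iff subset_iff)

lemma lookup_single_mult:
  fixes u m :: "'v \<Rightarrow>\<^sub>0 nat" and f :: "('v \<Rightarrow>\<^sub>0 nat) \<Rightarrow>\<^sub>0 complex"
  shows "lookup (Poly_Mapping.single m c * f) (m + u) = c * lookup f u"
proof -
  have "Poly_Mapping.single m c * f =
      (\<Sum>v\<in>keys f. Poly_Mapping.single m c * Poly_Mapping.single v (lookup f v))"
    by (subst (1) expansion_singles[of "keys f" f]) (simp_all add: sum_distrib_left)
  also have "\<dots> = (\<Sum>v\<in>keys f. Poly_Mapping.single (m + v) (c * lookup f v))"
    by (simp add: mult_single)
  finally show ?thesis
    by (simp add: lookup_sum lookup_single when_def in_keys_iff)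
qed

lemma lookup_single_mult_eq_0:
  fixes m :: "'v \<Rightarrow>\<^sub>0 nat" and f :: "('v \<Rightarrow>\<^sub>0 nat) \<Rightarrow>\<^sub>0 complex"
  assumes "\<And>u. v \<noteq> m + u"
  shows "lookup (Poly_Mapping.single m c * f) v = 0"
proof (rule ccontr)
  assume "\<not> ?thesis"
  then have "v \<in> keys (Poly_Mapping.single m c * f)"
    by (simp add: in_keys_iff)
  then show False
    using keys_mult[of "Poly_Mapping.single m c" f] assms
    by (auto split: if_splits)
qed

lemma weight_add: "weight w (u + v) = weight w u + weight w v"
  by (simp add: weight_def lookup_add algebra_simps sum.distrib)

lemma weight_scaleR: "weight (s *\<^sub>R w) u = s * weight w u"
  by (simp add: weight_def sum_distrib_left mult.assoc)

lemma lookup_initial_form: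
  "lookup (initial_form w f) u =
    (if \<forall>v\<in>keys f. weight w u \<le> weight w v then lookup f u else 0)"
  by (auto simp: initial_form_def lookup_sum lookup_single when_def in_keys_iff)

lemma keys_initial_form:
  "keys (initial_form w f) = {u \<in> keys f. \<forall>v\<in>keys f. weight w u \<le> weight w v}"
  by (auto simp: in_keys_iff lookup_initial_form split: if_splits)

text \<open>This says that the initial form of \<open>f\<close> is one term with exponent
  \<open>u\<close>. It concerns \<open>f\<close> alone, so it can be refuted by evaluating elements
  of an ideal.\<close>

definition isolated_lead :: "real ^ 'v::finite \<Rightarrow> 'v expo \<Rightarrow> 'v cpoly \<Rightarrow> bool" where
  "isolated_lead w u f \<longleftrightarrow> u \<in> keys f \<and> (\<forall>v\<in>keys f. v \<noteq> u \<longrightarrow> weight w u < weight w v)"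

lemma initial_form_isolated_lead:
  assumes "isolated_lead w u f"
  shows "initial_form w f = Poly_Mapping.single u (lookup f u)"
proof (intro poly_mapping_eqI)
  fix v
  have "keys (initial_form w f) = {u}"
    unfolding keys_initial_form using assms
    by (force simp: isolated_lead_def not_le[symmetric])
  moreover have "lookup (initial_form w f) u = lookup f u"
    using assms by (auto simp: lookup_initial_form isolated_lead_def intro: less_imp_le)
  ultimately show "lookup (initial_form w f) v = lookup (Poly_Mapping.single u (lookup f u)) v"
    using in_keys_iff[of v "initial_form w f"]
    by (cases "v = u") (simp_all add: lookup_single_not_eq)
qed

subsection \<open>Ideals\<close>

lemma ideal_generated_base: "x \<in> S \<Longrightarrow> x \<in> ideal_generated S"
  unfolding ideal_generated_def by (rule module.span_base[OF module_times])

lemma ideal_generated_0: "0 \<in> ideal_generated S"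
  unfolding ideal_generated_def by (rule module.span_zero[OF module_times])

lemma ideal_generated_add:
  "x \<in> ideal_generated S \<Longrightarrow> y \<in> ideal_generated S \<Longrightarrow> x + y \<in> ideal_generated S"
  unfolding ideal_generated_def by (rule module.span_add[OF module_times])

lemma ideal_generated_mult: "x \<in> ideal_generated S \<Longrightarrow> c * x \<in> ideal_generated S"
  unfolding ideal_generated_def by (rule module.span_scale[OF module_times])

lemma ideal_generated_induct [consumes 1, case_names base step]:
  assumes "x \<in> ideal_generated S" "P 0"
    "\<And>c x y. x \<in> S \<Longrightarrow> P y \<Longrightarrow> P (c * x + y)"
  shows "P x"
  using module.span_induct_alt[OF module_times assms(1)[unfolded ideal_generated_def], of P]
    assms(2,3) by blast

lemma initial_form_mem: "f \<in> I \<Longrightarrow> initial_form w f \<in> initial_ideal w I"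
  unfolding initial_ideal_def by (intro ideal_generated_base imageI)

text \<open>Every homogeneous component of an element of the initial ideal is zero or an initial form:
  initial forms of the same weight can be added inside the ideal.\<close>

lemma initial_ideal_component:
  fixes S :: "'v::finite cpoly set"
  defines "J \<equiv> ideal_generated S"
  assumes "g \<in> initial_ideal w J"
  shows "\<forall>e. \<exists>F\<in>J. (\<forall>v. weight w v < e \<longrightarrow> lookup F v = 0) \<and>
    (\<forall>v. weight w v = e \<longrightarrow> lookup F v = lookup g v)"
  using assms(2) unfolding initial_ideal_def
proof (induction g rule: ideal_generated_induct)
  case base
  show ?case
    by (auto intro!: bexI[of _ 0] simp: J_def ideal_generated_0)
next
  case (step c x y)
  \<comment> \<open>The factor \<open>c\<close> is arbitrary, so it is split into single terms. The
    claim is named to make it available for each product with one term and closed under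
    sums.\<close>
  define Q where "Q g \<longleftrightarrow> (\<forall>e. \<exists>F\<in>J. (\<forall>v. weight w v < e \<longrightarrow> lookup F v = 0) \<and>
    (\<forall>v. weight w v = e \<longrightarrow> lookup F v = lookup g v))" for g
  have Q_0: "Q 0"
    by (auto intro!: bexI[of _ 0] simp: J_def ideal_generated_0 Q_def)
  have Q_add: "Q (g + h)" if "Q g" "Q h" for g h
    unfolding Q_def
  proof
    fix e
    obtain F where "F \<in> J"
      "\<forall>v. weight w v < e \<longrightarrow> lookup F v = 0" "\<forall>v. weight w v = e \<longrightarrow> lookup F v = lookup g v"
      using \<open>Q g\<close> unfolding Q_def by blast
    moreover obtain G where "G \<in> J"
      "\<forall>v. weight w v < e \<longrightarrow> lookup G v = 0" "\<forall>v. weight w v = e \<longrightarrow> lookup G v = lookup h v"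
      using \<open>Q h\<close> unfolding Q_def by blast
    ultimately show "\<exists>F\<in>J. (\<forall>v. weight w v < e \<longrightarrow> lookup F v = 0) \<and>
      (\<forall>v. weight w v = e \<longrightarrow> lookup F v = lookup (g + h) v)"
      by (intro bexI[of _ "F + G"]) (auto simp: lookup_add J_def ideal_generated_add)
  qed
  obtain f where f: "f \<in> J" "x = initial_form w f"
    using step by auto
  have Q_single: "Q (Poly_Mapping.single m a * x)" for m a
    unfolding Q_def
  proof
    fix e
    show "\<exists>F\<in>J. (\<forall>v. weight w v < e \<longrightarrow> lookup F v = 0) \<and>
      (\<forall>v. weight w v = e \<longrightarrow> lookup F v = lookup (Poly_Mapping.single m a * x) v)"
    \<comment> \<open>All terms of the initial form \<open>x\<close> have the same weight, and
      multiplication by one term shifts it by \<open>weight w m\<close>. Either the shifted weight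
      is \<open>e\<close>, and the same multiple of \<open>f\<close> is the witness, or the
      component at \<open>e\<close> is zero.\<close>
    proof (cases "\<exists>u\<in>keys x. weight w (m + u) = e")
      case True
      then obtain u where u: "u \<in> keys x" "weight w (m + u) = e" by auto
      let ?F = "Poly_Mapping.single m a * f"
      have min: "weight w u \<le> weight w v" if "v \<in> keys f" for v
        using u that by (auto simp: f keys_initial_form)
      have "lookup ?F v = 0" if "weight w v < e" for v
      proof (cases "\<exists>v'. v = m + v'")
        case True
        then obtain v' where v': "v = m + v'" by auto
        then have "v' \<notin> keys f"
          using that min[of v'] u(2) by (auto simp: weight_add)
        then show ?thesis by (simp add: v' lookup_single_mult in_keys_iff)
      qed (simp add: lookup_single_mult_eq_0)
      moreover have "lookup ?F v = lookup (Poly_Mapping.single m a * x) v" if "weight w v = e" for v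
      proof (cases "\<exists>v'. v = m + v'")
        case True
        then obtain v' where v': "v = m + v'" by auto
        then have "weight w v' = weight w u"
          using that u(2) by (simp add: weight_add)
        then show ?thesis
          using min by (simp add: v' lookup_single_mult f lookup_initial_form)
      qed (simp add: lookup_single_mult_eq_0)
      moreover have "?F \<in> J"
        using f by (simp add: J_def ideal_generated_mult)
      ultimately show ?thesis by blast
    next
      case False
      have "lookup (Poly_Mapping.single m a * x) v = 0" if "weight w v = e" for v
      proof (cases "\<exists>v'. v = m + v'")
        case True
        then obtain v' where v': "v = m + v'" by auto
        then have "v' \<notin> keys x" using False that by auto
        then show ?thesis by (simp add: v' lookup_single_mult in_keys_iff)
      qed (simp add: lookup_single_mult_eq_0)
      then show ?thesis
        by (intro bexI[of _ 0]) (auto simp: J_def ideal_generated_0)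
    qed
  qed
  have "Q (\<Sum>m\<in>A. Poly_Mapping.single m (lookup c m) * x)" if "finite A" for A
    using that by induction (auto intro: Q_0 Q_add Q_single)
  from this[of "keys c"] have "Q (c * x)"
    by (subst expansion_singles[of "keys c" c]) (simp_all add: sum_distrib_right)
  then show ?case
    using step Q_add unfolding Q_def by blast
qed

text \<open>The component of \<open>g\<close> in the weight of \<open>u\<close> is a single term. An
  ideal element with this component and nothing of lower weight has \<open>u\<close> as its isolated
  lead.\<close>

lemma initial_ideal_isolated_lead:
  assumes "g \<in> initial_ideal w (ideal_generated S)" "u \<in> keys g"
    and "\<And>v. v \<in> keys g \<Longrightarrow> v \<noteq> u \<Longrightarrow> weight w v \<noteq> weight w u"
  shows "\<exists>F\<in>ideal_generated S. isolated_lead w u F"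
proof -
  obtain F where F: "F \<in> ideal_generated S"
    and lt: "\<And>v. weight w v < weight w u \<Longrightarrow> lookup F v = 0"
    and eq: "\<And>v. weight w v = weight w u \<Longrightarrow> lookup F v = lookup g v"
    using initial_ideal_component[OF assms(1)] by metis
  have "u \<in> keys F" using eq[of u] assms(2) by (simp add: in_keys_iff)
  moreover have "weight w u < weight w v" if "v \<in> keys F" "v \<noteq> u" for v
  proof (rule ccontr)
    assume "\<not> ?thesis"
    then consider "weight w v < weight w u" | "weight w v = weight w u" by linarith
    then show False
      using lt[of v] eq[of v] assms(3)[of v] that by cases (auto simp: in_keys_iff)
  qed
  ultimately show ?thesis using F by (auto simp: isolated_lead_def)
qed

lemma monomial_mem_initial_ideal:
  assumes "f \<in> I" "isolated_lead w u f"
  shows "\<exists>c. c \<noteq> 0 \<and> Poly_Mapping.single u c \<in> initial_ideal w I"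
  using assms initial_form_mem[of f I w] initial_form_isolated_lead[of w u f]
  by (auto simp: isolated_lead_def in_keys_iff)

text \<open>A monomial in the initial ideal is its own component, so it is already the initial form
  of one element of the ideal. No combinations of initial forms remain to be considered.\<close>

lemma tropical_variety_iff:
  "w \<in> tropical_variety (ideal_generated S) \<longleftrightarrow> (\<nexists>f u. f \<in> ideal_generated S \<and> isolated_lead w u f)"
proof -
  have "\<exists>f\<in>ideal_generated S. isolated_lead w u f"
    if "Poly_Mapping.single u c \<in> initial_ideal w (ideal_generated S)" "c \<noteq> 0" for u c
    by (rule initial_ideal_isolated_lead[OF that(1)]) (use that in auto)
  then show ?thesis
    using monomial_mem_initial_ideal
    unfolding tropical_variety_def is_monomial_def by blast
qed

text \<open>The \<open>w'\<close>-initial form of \<open>f\<close> also lies in the initial ideal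
  for \<open>w\<close>, and its \<open>w\<close>-component at \<open>u\<close> is a single
  term.\<close>

lemma initial_ideal_eq_isolated_lead:
  fixes S :: "'v::finite cpoly set"
  defines "J \<equiv> ideal_generated S"
  assumes eq: "initial_ideal w' J = initial_ideal w J" and f: "f \<in> J"
    and u: "u \<in> keys (initial_form w' f)"
    and iso: "\<And>v. v \<in> keys (initial_form w' f) \<Longrightarrow> v \<noteq> u \<Longrightarrow> weight w v \<noteq> weight w u"
  shows "\<exists>F\<in>J. isolated_lead w u F"
  unfolding J_def
proof (rule initial_ideal_isolated_lead)
  show "initial_form w' f \<in> initial_ideal w (ideal_generated S)"
    using initial_form_mem[OF f, of w'] eq by (simp add: J_def)
qed (use u iso in auto)

text \<open>Transfer twice: from \<open>w\<close> to \<open>w'\<close> this gives an element whose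
  \<open>w'\<close>-initial form is a monomial at \<open>u\<close>, and this monomial is carried
  back to \<open>w\<close>. So if \<open>u\<close> is no lead for \<open>w\<close>, then
  \<open>w'\<close> must give \<open>u\<close> the same weight as another term.\<close>

lemma initial_ideal_eq_isolated_lead':
  fixes S :: "'v::finite cpoly set"
  defines "J \<equiv> ideal_generated S"
  assumes eq: "initial_ideal w' J = initial_ideal w J" and f: "f \<in> J"
    and u: "u \<in> keys (initial_form w f)"
    and iso: "\<And>v. v \<in> keys (initial_form w f) \<Longrightarrow> v \<noteq> u \<Longrightarrow> weight w' v \<noteq> weight w' u"
  shows "\<exists>F\<in>J. isolated_lead w u F"
proof -
  obtain F where F: "F \<in> J" "isolated_lead w' u F"
    using initial_ideal_eq_isolated_lead[OF eq[symmetric, unfolded J_def] f[unfolded J_def] u]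
      iso by (auto simp: J_def)
  then have "initial_form w' F = Poly_Mapping.single u (lookup F u)" "lookup F u \<noteq> 0"
    by (auto simp: initial_form_isolated_lead isolated_lead_def in_keys_iff)
  then show ?thesis
    using initial_ideal_eq_isolated_lead[OF eq[unfolded J_def] F(1)[unfolded J_def], of u]
    by (auto simp: J_def)
qed

subsection \<open>Evaluation\<close>

definition eval_expo :: "('v::finite \<Rightarrow> complex poly) \<Rightarrow> 'v expo \<Rightarrow> complex poly" where
  "eval_expo g u = (\<Prod>i\<in>UNIV. g i ^ lookup u i)"

definition eval_cpoly :: "('v::finite \<Rightarrow> complex poly) \<Rightarrow> 'v cpoly \<Rightarrow> complex poly" where
  "eval_cpoly g f = (\<Sum>u\<in>keys f. smult (lookup f u) (eval_expo g u))"

lemma eval_expo_add: "eval_expo g (u + v) = eval_expo g u * eval_expo g v"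
  by (simp add: eval_expo_def lookup_add power_add prod.distrib)

lemma eval_expo_0 [simp]: "eval_expo g 0 = 1"
  by (simp add: eval_expo_def)

lemma eval_cpoly_superset:
  assumes "finite A" "keys f \<subseteq> A"
  shows "eval_cpoly g f = (\<Sum>u\<in>A. smult (lookup f u) (eval_expo g u))"
  unfolding eval_cpoly_def
  by (rule sum.mono_neutral_left) (use assms in \<open>auto simp: in_keys_iff\<close>)

lemma eval_cpoly_0 [simp]: "eval_cpoly g 0 = 0"
  by (simp add: eval_cpoly_def)

lemma eval_cpoly_single [simp]: "eval_cpoly g (Poly_Mapping.single u c) = smult c (eval_expo g u)"
  by (subst eval_cpoly_superset[of "{u}"]) auto

lemma eval_cpoly_add: "eval_cpoly g (f + h) = eval_cpoly g f + eval_cpoly g h"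
proof -
  let ?A = "keys f \<union> keys h"
  have "keys (f + h) \<subseteq> ?A" by (rule keys_add)
  then show ?thesis
    by (simp add: eval_cpoly_superset[of ?A] lookup_add smult_add_left sum.distrib)
qed

lemma eval_cpoly_uminus: "eval_cpoly g (- f) = - eval_cpoly g f"
  by (simp add: eval_cpoly_def keys_minus sum_negf)

lemma eval_cpoly_diff: "eval_cpoly g (f - h) = eval_cpoly g f - eval_cpoly g h"
  using eval_cpoly_add[of g f "- h"] by (simp add: eval_cpoly_uminus)

lemma eval_cpoly_sum: "eval_cpoly g (\<Sum>x\<in>A. f x) = (\<Sum>x\<in>A. eval_cpoly g (f x))"
  by (induction A rule: infinite_finite_induct) (auto simp: eval_cpoly_add)

lemma eval_cpoly_mult: "eval_cpoly g (f * h) = eval_cpoly g f * eval_cpoly g h"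
proof -
  have "f * h = (\<Sum>u\<in>keys f. \<Sum>v\<in>keys h. Poly_Mapping.single (u + v) (lookup f u * lookup h v))"
    using arg_cong2[OF expansion_singles[of "keys f" f] expansion_singles[of "keys h" h],
        where f = "(*)"]
    by (simp add: sum_product mult_single)
  then show ?thesis
    by (simp add: eval_cpoly_sum eval_expo_add eval_cpoly_def[of g f] eval_cpoly_def[of g h]
        sum_product mult_ac)
qed

lemma eval_cpoly_1 [simp]: "eval_cpoly g 1 = 1"
  by (simp flip: single_one)

lemma eval_cpoly_power: "eval_cpoly g (f ^ n) = eval_cpoly g f ^ n"
  by (induction n) (auto simp: eval_cpoly_mult)

lemma eval_cpoly_Var [simp]: "eval_cpoly g (Var i) = g i"
proof -
  have "eval_expo g (Poly_Mapping.single i 1) = (\<Prod>j\<in>UNIV. if j = i then g i else 1)"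
    unfolding eval_expo_def by (rule prod.cong) (auto simp: lookup_single when_def)
  then show ?thesis by (simp add: Var_def)
qed

lemma eval_cpoly_ideal_generated:
  assumes "f \<in> ideal_generated S" "\<And>h. h \<in> S \<Longrightarrow> eval_cpoly g h = 0"
  shows "eval_cpoly g f = 0"
  using assms(1)
  by (induction rule: ideal_generated_induct)
     (auto simp: eval_cpoly_add eval_cpoly_mult assms(2))

section \<open>Linear independence from the monomials of larger weight\<close>

definition poly_subspace :: "complex poly set \<Rightarrow> bool" where
  "poly_subspace V \<longleftrightarrow> 0 \<in> V \<and> (\<forall>p\<in>V. \<forall>q\<in>V. p + q \<in> V) \<and> (\<forall>c. \<forall>p\<in>V. smult c p \<in> V)"

text \<open>The value of the monomial \<open>u\<close> is linearly independent of the values of the monomials of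
  larger weight.\<close>

definition standard_expo :: "('v::finite \<Rightarrow> complex poly) \<Rightarrow> real ^ 'v \<Rightarrow> 'v expo \<Rightarrow> bool" where
  "standard_expo g w u \<longleftrightarrow> (\<exists>V. poly_subspace V \<and> eval_expo g u \<notin> V \<and>
     (\<forall>v. weight w u < weight w v \<longrightarrow> eval_expo g v \<in> V))"

text \<open>Solving the relation \<open>eval_cpoly g f = 0\<close> for the term at \<open>u\<close>
  would write its value as a combination of values of monomials of larger weight, all in the
  subspace that avoids it.\<close>

lemma standard_expo_not_lead:
  assumes "standard_expo g w u" "eval_cpoly g f = 0"
  shows "\<not> isolated_lead w u f"
proof
  assume lead: "isolated_lead w u f"
  obtain V where V: "poly_subspace V" "eval_expo g u \<notin> V"
    "\<And>v. weight w u < weight w v \<Longrightarrow> eval_expo g v \<in> V"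
    using assms(1) unfolding standard_expo_def by blast
  have sum_mem: "(\<Sum>v\<in>A. smult (lookup f v) (eval_expo g v)) \<in> V"
    if "finite A" "A \<subseteq> {v. weight w u < weight w v}" for A
    using that by (induction) (use V in \<open>auto simp: poly_subspace_def\<close>)
  let ?r = "\<Sum>v\<in>keys f - {u}. smult (lookup f v) (eval_expo g v)"
  have u: "u \<in> keys f" using lead by (simp add: isolated_lead_def)
  then have "smult (lookup f u) (eval_expo g u) + ?r = 0"
    using assms(2) unfolding eval_cpoly_def by (simp add: sum.remove)
  then have "smult (- 1 / lookup f u) ?r = smult (1 / lookup f u) (smult (lookup f u) (eval_expo g u))"
    by (simp add: add_eq_0_iff)
  also have "\<dots> = eval_expo g u"
    using u by (simp add: in_keys_iff)
  finally have "eval_expo g u = smult (- 1 / lookup f u) ?r" ..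
  moreover have "?r \<in> V"
    by (rule sum_mem) (use lead in \<open>auto simp: isolated_lead_def\<close>)
  ultimately show False
    using V(1,2) unfolding poly_subspace_def by metis
qed

subsection \<open>Pade relations\<close>

text \<open>Each derivative lowers the multiplicity of a zero by at most one. Truncated subtraction
  makes the claim trivial for \<open>n\<close> beyond \<open>m\<close>.\<close>

lemma linear_power_dvd_higher_pderiv:
  fixes q :: "complex poly"
  assumes "[:- c, 1:] ^ m dvd q"
  shows "[:- c, 1:] ^ (m - n) dvd (pderiv ^^ n) q"
proof (induction n)
  case 0
  then show ?case using assms by simp
next
  case (Suc n)
  show ?case
  proof (cases "m - n")
    case (Suc k)
    obtain r where "(pderiv ^^ n) q = [:- c, 1:] ^ Suc k * r"
      using Suc.IH Suc by (auto elim: dvdE)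
    then have "pderiv ((pderiv ^^ n) q) =
        [:- c, 1:] ^ Suc k * pderiv r + smult (of_nat (Suc k)) (r * [:- c, 1:] ^ k)"
      by (simp only: lemma_order_pderiv1)
    moreover have "[:- c, 1:] ^ k dvd \<dots>"
      by (intro dvd_add dvd_smult dvd_mult dvd_refl dvd_mult2 le_imp_power_dvd) simp
    moreover have "m - Suc n = k" using Suc by simp
    ultimately show ?thesis by simp
  qed simp
qed

lemma antiderivative_poly:
  fixes P :: "complex poly"
  shows "\<exists>Q. pderiv Q = P \<and> poly Q c = 0"
proof -
  let ?Q = "\<Sum>k\<le>degree P. monom (coeff P k / of_nat (Suc k)) (Suc k)"
  have "pderiv ?Q = (\<Sum>k\<le>degree P. monom (coeff P k) k)"
    using higher_pderiv_sum[of 1 "\<lambda>k. monom (coeff P k / of_nat (Suc k)) (Suc k)" "{..degree P}"]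
    by (simp add: pderiv_monom del: of_nat_Suc)
  then have "pderiv (?Q - [:poly ?Q c:]) = P"
    by (simp add: pderiv_diff poly_as_sum_of_monoms)
  then show ?thesis by (intro exI[of _ "?Q - [:poly ?Q c:]"]) simp
qed

text \<open>Choosing the antiderivative that vanishes at \<open>c\<close> raises the order of
  vanishing at \<open>c\<close> by one. The polynomials stay nonzero, so \<open>order\<close>
  expresses divisibility.\<close>

lemma higher_antiderivative_poly:
  fixes P :: "complex poly"
  assumes "P \<noteq> 0" "[:- c, 1:] ^ m dvd P"
  shows "\<exists>Q. (pderiv ^^ n) Q = P \<and> [:- c, 1:] ^ (m + n) dvd Q"
proof (induction n)
  case 0
  then show ?case using assms by auto
next
  case (Suc n)
  then obtain Q where Q: "(pderiv ^^ n) Q = P" "[:- c, 1:] ^ (m + n) dvd Q" by blast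
  have "Q \<noteq> 0" using Q(1) assms(1) by auto
  obtain R where R: "pderiv R = Q" "poly R c = 0" using antiderivative_poly by blast
  have "R \<noteq> 0" using R \<open>Q \<noteq> 0\<close> by auto
  then have "order c R = Suc (order c Q)" using R order_pderiv by metis
  then have "[:- c, 1:] ^ (m + Suc n) dvd R"
    using Q(2) \<open>Q \<noteq> 0\<close> by (simp add: order_divides del: power_Suc)
  moreover have "(pderiv ^^ Suc n) R = P"
    using R(1) Q(1) by (simp add: funpow_swap1)
  ultimately show ?case by blast
qed

text \<open>Replacing the factor 1 in \<open>u' * a ^ m * 1\<close> by the given combination raises
  the exponent of \<open>a\<close>. The same argument with exchanged roles then raises that of
  \<open>b\<close>.\<close>

lemma bezout_powers:
  fixes a b :: "'a::comm_ring_1"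
  assumes "u * a + v * b = 1"
  shows "\<exists>u v. u * a ^ m + v * b ^ n = 1"
proof -
  have *: "\<exists>u v. u * a ^ m + v * b = 1" if "u * a + v * b = 1" for u v a b :: 'a and m
  proof (induction m)
    case 0
    then show ?case by (intro exI[of _ 1] exI[of _ 0]) simp
  next
    case (Suc m)
    then obtain u' v' where uv: "u' * a ^ m + v' * b = 1" by blast
    have "(u' * u) * a ^ Suc m + (u' * a ^ m * v + v') * b
        = u' * a ^ m * (u * a + v * b) + v' * b"
      by (simp add: algebra_simps)
    then show ?case using uv that by (metis mult.right_neutral)
  qed
  obtain u v where "v * b + u * a ^ m = 1" using *[OF assms] by (metis add.commute)
  from *[OF this] show ?thesis by (metis add.commute)
qed

lemma linear_powers_mult_dvd:
  fixes q :: "complex poly"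
  assumes "[:1, 1:] ^ m dvd q" "[:- 1, 1:] ^ n dvd q"
  shows "[:1, 1:] ^ m * [:- 1, 1:] ^ n dvd q"
proof -
  \<comment> \<open>Coprimality of the two linear factors: (t + 1)/2 - (t - 1)/2 = 1.\<close>
  have "[:1 / 2:] * [:1, 1:] + [:- 1 / 2:] * [:- 1, 1 :: complex:] = 1"
    by (simp add: one_pCons)
  from bezout_powers[OF this, of m n]
  obtain u v :: "complex poly" where uv: "u * [:1, 1:] ^ m + v * [:- 1, 1:] ^ n = 1"
    by (elim exE)
  have "q = (u * [:1, 1:] ^ m + v * [:- 1, 1:] ^ n) * q"
    unfolding uv by simp
  also have "\<dots> = u * ([:1, 1:] ^ m * q) + v * (q * [:- 1, 1:] ^ n)"
    by (simp only: ring_distribs mult_ac)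
  finally have "q = u * ([:1, 1:] ^ m * q) + v * (q * [:- 1, 1:] ^ n)" .
  moreover have "[:1, 1:] ^ m * [:- 1, 1:] ^ n dvd u * ([:1, 1:] ^ m * q)"
    using assms(2) by (intro dvd_mult mult_dvd_mono dvd_refl)
  moreover have "[:1, 1:] ^ m * [:- 1, 1:] ^ n dvd v * (q * [:- 1, 1:] ^ n)"
    using assms(1) by (intro dvd_mult mult_dvd_mono dvd_refl)
  ultimately show ?thesis by (metis dvd_add)
qed

text \<open>Differentiating \<open>n\<close> times kills \<open>C\<close>. The \<open>n\<close>-th derivative of \<open>A (t + 1)\<^bsup>p+2\<^esup>\<close> is then divisible
  by \<open>(t + 1)\<^bsup>p+2-n\<^esup> (t - 1)\<^bsup>p-n\<^esup>\<close>, whose degree is too large.\<close>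

lemma pade_unique:
  fixes A B C :: "complex poly"
  assumes rel: "A * [:1, 1:] ^ (p + 2) + B * [:- 1, 1:] ^ p + C = 0" and "n \<le> p"
    and C: "\<And>l. n \<le> l \<Longrightarrow> coeff C l = 0" and A: "\<And>l. p - n \<le> l \<Longrightarrow> coeff A l = 0"
  shows "A = 0 \<and> B = 0 \<and> C = 0"
proof -
  define U where "U = (pderiv ^^ n) (A * [:1, 1:] ^ (p + 2))"
  have "(pderiv ^^ n) C = 0"
    by (rule poly_eqI) (simp add: coeff_higher_pderiv C)
  moreover have "(pderiv ^^ n) (A * [:1, 1:] ^ (p + 2) + B * [:- 1, 1:] ^ p + C) = 0"
    by (simp only: rel higher_pderiv_0)
  ultimately have U': "U = - (pderiv ^^ n) (B * [:- 1, 1:] ^ p)"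
    by (simp add: U_def higher_pderiv_add add_eq_0_iff2)
  have "[:1, 1:] ^ (p + 2 - n) dvd U"
    unfolding U_def using linear_power_dvd_higher_pderiv[of "- 1" "p + 2" "A * [:1, 1:] ^ (p + 2)" n]
    by simp
  \<comment> \<open>The relation gives a second expression for \<open>U\<close>, through
    \<open>B\<close>, and thereby a second prescribed zero.\<close>
  moreover have "[:- 1, 1:] ^ (p - n) dvd U"
    unfolding U' using linear_power_dvd_higher_pderiv[of 1 p "B * [:- 1, 1:] ^ p" n]
    by simp
  ultimately have dvd: "[:1, 1:] ^ (p + 2 - n) * [:- 1, 1:] ^ (p - n) dvd U"
    by (rule linear_powers_mult_dvd)
  have "A = 0"
  proof (rule ccontr)
    assume "A \<noteq> 0"
    then have "degree A < p - n"
      using A[of "degree A"] by (meson leading_coeff_0_iff not_le)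
    have deg: "degree U = degree A + (p + 2 - n)"
      unfolding U_def degree_higher_pderiv using \<open>A \<noteq> 0\<close> \<open>n \<le> p\<close>
      by (subst degree_mult_eq) (auto simp: degree_power_eq simp del: power_Suc)
    then have "U \<noteq> 0" using \<open>n \<le> p\<close> by auto
    then have "degree ([:1, 1:] ^ (p + 2 - n) * [:- 1, 1 :: complex:] ^ (p - n)) \<le> degree U"
      using dvd dvd_imp_degree_le by blast
    then show False
      using deg \<open>degree A < p - n\<close> by (simp add: degree_mult_eq degree_power_eq)
  qed
  \<comment> \<open>Without \<open>A\<close>, a nonzero \<open>B\<close> would force
    \<open>C\<close> to have degree at least \<open>p\<close>, hence at least
    \<open>n\<close>.\<close>
  then have BC: "B * [:- 1, 1:] ^ p = - C" using rel by (simp add: add_eq_0_iff2)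
  have "B = 0"
  proof (rule ccontr)
    assume "B \<noteq> 0"
    then have "degree C = degree B + p"
      by (metis BC degree_minus degree_mult_eq degree_linear_power one_neq_zero pCons_eq_0_iff
          power_not_zero)
    then have "coeff C (degree C) = 0" using \<open>n \<le> p\<close> by (intro C) simp
    then show False using BC \<open>B \<noteq> 0\<close> by simp
  qed
  then show ?thesis using \<open>A = 0\<close> BC by simp
qed

text \<open>If the extremal coefficient of \<open>C\<close> or of \<open>A\<close> vanishes,
  \<open>pade_unique\<close> applies with \<open>n\<close> equal to \<open>p - 1 - i\<close> or
  \<open>p - i\<close>. If that of \<open>B\<close> vanishes, nothing can cancel the leading term of
  \<open>A\<close> times (t + 1)^(p+2), so the coefficient of \<open>A\<close> vanishes as
  well.\<close>

lemma pade_normal: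
  fixes A B C :: "complex poly"
  assumes rel: "A * [:1, 1:] ^ (p + 2) + B * [:- 1, 1:] ^ p + C = 0" and "i < p"
    and deg: "degree A \<le> i" "degree C \<le> p - 1 - i"
    and zero: "coeff A i = 0 \<or> coeff B (i + 2) = 0 \<or> coeff C (p - 1 - i) = 0"
    and B: "degree B \<le> i + 2"
  shows "A = 0 \<and> B = 0 \<and> C = 0"
proof (cases "coeff C (p - 1 - i) = 0")
  case True
  show ?thesis
  proof (rule pade_unique[OF rel, of "p - 1 - i"])
    show "coeff C l = 0" if "p - 1 - i \<le> l" for l
      using True that deg(2) by (cases "l = p - 1 - i") (auto intro: coeff_eq_0)
    show "coeff A l = 0" if "p - (p - 1 - i) \<le> l" for l
      using that deg(1) \<open>i < p\<close> by (auto intro: coeff_eq_0)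
  qed simp
next
  case False
  have "coeff A i = 0"
  proof (rule ccontr)
    assume A: "coeff A i \<noteq> 0"
    then have "degree A = i" using deg(1) le_degree by force
    have "coeff B (i + 2) = 0" using zero A False by blast
    then have "degree B < i + 2"
      using B by (metis add_2_eq_Suc' le_neq_implies_less degree_0 leading_coeff_0_iff zero_less_Suc)
    have "A * [:1, 1:] ^ (p + 2) = - (B * [:- 1, 1:] ^ p + C)"
      using rel by (simp only: eq_neg_iff_add_eq_0 add.assoc)
    moreover have "degree (A * [:1, 1:] ^ (p + 2)) = i + (p + 2)"
      using A \<open>degree A = i\<close> by (subst degree_mult_eq) (auto simp: degree_power_eq simp del: power_Suc)
    moreover have "degree (B * [:- 1, 1:] ^ p) < i + (p + 2)"
      using degree_mult_le[of B "[:- 1, 1:] ^ p"] \<open>degree B < i + 2\<close>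
      by (simp add: degree_power_eq)
    then have "degree (B * [:- 1, 1:] ^ p + C) < i + (p + 2)"
      using deg(2) by (intro degree_add_less) auto
    ultimately show False by (simp only: degree_minus)
  qed
  show ?thesis
  proof (rule pade_unique[OF rel, of "p - i"])
    show "coeff C l = 0" if "p - i \<le> l" for l
      using that deg(2) \<open>i < p\<close> by (auto intro: coeff_eq_0)
    show "coeff A l = 0" if "p - (p - i) \<le> l" for l
      using that deg(1) \<open>i < p\<close> \<open>coeff A i = 0\<close>
      by (cases "l = i") (auto intro: coeff_eq_0)
  qed simp
qed

text \<open>Integrate (t + 1)^(i+2) (t - 1)^i exactly p - i times, once with zeros at -1 and once at
  1. The results are divisible by (t + 1)^(p+2) and (t - 1)^p, and they differ by a polynomial
  \<open>C\<close> of degree below p - i.\<close>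

lemma pade_exists:
  assumes "i < p"
  obtains A B C :: "complex poly"
  where "A * [:1, 1:] ^ (p + 2) + B * [:- 1, 1:] ^ p + C = 0"
    "degree A = i" "degree B = i + 2" "degree C = p - 1 - i" "A \<noteq> 0" "B \<noteq> 0" "C \<noteq> 0"
proof -
  let ?P = "[:1, 1:] ^ (i + 2) * [:- 1, 1:] ^ i :: complex poly"
  let ?n = "p - i"
  have P: "?P \<noteq> 0" "degree ?P = 2 * i + 2"
    by (simp_all add: degree_mult_eq degree_power_eq del: power_Suc)
  obtain U where U: "(pderiv ^^ ?n) U = ?P" "[:- (- 1), 1:] ^ (i + 2 + ?n) dvd U"
    using higher_antiderivative_poly[OF P(1), of "- 1" "i + 2" ?n] by auto
  obtain V where V: "(pderiv ^^ ?n) V = ?P" "[:- 1, 1:] ^ (i + ?n) dvd V"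
    using higher_antiderivative_poly[OF P(1), of 1 i ?n] by auto
  have "i + ?n = p" "i + 2 + ?n = p + 2" using assms by auto
  then obtain A B where A: "U = [:1, 1:] ^ (p + 2) * A" and B: "V = [:- 1, 1:] ^ p * B"
    using U(2) V(2) by (auto elim!: dvdE)
  define C where "C = V - U"
  have rel: "A * [:1, 1:] ^ (p + 2) + (- B) * [:- 1, 1:] ^ p + C = 0"
    by (simp add: C_def A B algebra_simps)
  have "degree U - ?n = 2 * i + 2" "degree V - ?n = 2 * i + 2"
    using U(1) V(1) P(2) by (metis degree_higher_pderiv)+
  then have "degree U = p + 2 + i" "degree V = p + 2 + i" using assms by auto
  moreover from this have "A \<noteq> 0" "B \<noteq> 0" by (auto simp: A B)
  ultimately have degA: "degree A = i" and degB: "degree B = i + 2"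
    by (simp_all add: A B degree_mult_eq degree_power_eq del: power_Suc)
  have "(pderiv ^^ ?n) (C + U) = (pderiv ^^ ?n) V" by (simp add: C_def)
  then have "(pderiv ^^ ?n) C = 0"
    unfolding higher_pderiv_add U(1) V(1) by simp
  then have "coeff ((pderiv ^^ ?n) C) l = 0" for l by simp
  \<comment> \<open>The Pochhammer symbol is the factor that differentiation puts on a coefficient.
    As it is nonzero, the coefficients of \<open>C\<close> from p - i on vanish.\<close>
  moreover have "pochhammer (of_nat (Suc l)) ?n \<noteq> (0 :: complex)" for l
    using pochhammer_pos[of "Suc l" ?n]
    by (simp only: pochhammer_of_nat of_nat_eq_0_iff zero_less_Suc) simp
  ultimately have "coeff C (l + ?n) = 0" for l
    unfolding coeff_higher_pderiv mult_eq_0_iff by blast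
  then have "coeff C l = 0" if "p - i \<le> l" for l
    using that by (metis le_add_diff_inverse2)
  then have degC: "degree C \<le> p - 1 - i"
    using assms by (intro degree_le) auto
  \<comment> \<open>Otherwise \<open>pade_normal\<close> would make the whole relation trivial,
    against \<open>A \<noteq> 0\<close>.\<close>
  then have "coeff C (p - 1 - i) \<noteq> 0"
    using pade_normal[OF rel assms] degA degB \<open>A \<noteq> 0\<close> by auto
  then have "degree C = p - 1 - i" "C \<noteq> 0" using degC le_degree by force+
  with rel degA degB \<open>A \<noteq> 0\<close> \<open>B \<noteq> 0\<close> show thesis by (intro that[of A "- B" C]) auto
qed

subsection \<open>Homogenization and rays of the Groebner fan\<close>

lemma lookup_homogenize_expo_None [simp]:
  "lookup (homogenize_expo d u) None = d - expo_degree u"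
  by (simp add: homogenize_expo_def lookup_add lookup_sum lookup_single)

lemma lookup_homogenize_expo_Some [simp]: "lookup (homogenize_expo d u) (Some i) = lookup u i"
  by (simp add: homogenize_expo_def lookup_add lookup_sum lookup_single when_def)

lemma homogenize_expo_eq_iff [simp]: "homogenize_expo d u = homogenize_expo d v \<longleftrightarrow> u = v"
  by (metis lookup_homogenize_expo_Some poly_mapping_eqI)

lemma map_key_homogenize_expo [simp]: "Poly_Mapping.map_key Some (homogenize_expo d u) = u"
  by (rule poly_mapping_eqI) (simp add: map_key.rep_eq)

lemma lookup_homogenize:
  "lookup (homogenize f) (homogenize_expo (total_degree f) u) = lookup f u"
  by (simp add: homogenize_def lookup_sum lookup_single when_def in_keys_iff)

lemma keys_homogenize: "keys (homogenize f) = homogenize_expo (total_degree f) ` keys f"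
proof
  show "keys (homogenize f) \<subseteq> homogenize_expo (total_degree f) ` keys f"
    unfolding homogenize_def by (rule order.trans[OF keys_sum]) auto
  show "homogenize_expo (total_degree f) ` keys f \<subseteq> keys (homogenize f)"
    by (auto simp: in_keys_iff lookup_homogenize)
qed

lemma expo_degree_le_total_degree: "u \<in> keys f \<Longrightarrow> expo_degree u \<le> total_degree f"
  by (simp add: total_degree_def)

lemma sum_UNIV_option: "(\<Sum>j\<in>UNIV. h j) = h None + (\<Sum>i\<in>UNIV. h (Some (i :: 'v::finite)))"
  by (simp add: UNIV_option_conv sum.reindex)

lemma prod_UNIV_option: "(\<Prod>j\<in>UNIV. h j) = h None * (\<Prod>i\<in>UNIV. h (Some (i :: 'v::finite)))"
  by (simp add: UNIV_option_conv prod.reindex)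

text \<open>Subtracting a constant from all entries of a weight changes the weights of all monomials
  of one degree by the same amount. So on a homogenization \<open>W\<close> compares terms as
  \<open>dehom_weight W\<close> does on the original polynomial.\<close>

definition dehom_weight :: "real ^ 'v::finite option \<Rightarrow> real ^ 'v" where
  "dehom_weight W = (\<chi> i. W $ Some i - W $ None)"

lemma lift_weight_nth [simp]: "lift_weight w $ None = 0" "lift_weight w $ Some i = w $ i"
  by (simp_all add: lift_weight_def)

lemma dehom_lift_weight [simp]: "dehom_weight (lift_weight w) = w"
  by (simp add: dehom_weight_def vec_eq_iff)

lemma lift_weight_scaleR: "lift_weight (t *\<^sub>R w) = t *\<^sub>R lift_weight w"
  by (simp add: vec_eq_iff lift_weight_def split: option.split)

lemma weight_homogenize_expo:
  assumes "expo_degree u \<le> d"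
  shows "weight W (homogenize_expo d u) = W $ None * real d + weight (dehom_weight W) u"
  using assms
  by (simp add: weight_def sum_UNIV_option dehom_weight_def of_nat_diff expo_degree_def
      algebra_simps sum_subtractf sum_distrib_left)

lemma weight_lift_weight: "weight (lift_weight w) u = weight w (Poly_Mapping.map_key Some u)"
  by (simp add: weight_def sum_UNIV_option map_key.rep_eq)

lemma keys_initial_form_homogenize:
  "keys (initial_form W (homogenize f)) =
    homogenize_expo (total_degree f) ` keys (initial_form (dehom_weight W) f)"
  by (auto simp: keys_initial_form keys_homogenize weight_homogenize_expo
      expo_degree_le_total_degree)

lemma homogenize_mem: "f \<in> I \<Longrightarrow> homogenize f \<in> homogenize_ideal I"
  unfolding homogenize_ideal_def by (intro ideal_generated_base imageI)

text \<open>Setting the homogenizing variable to 1 extends the parametrization to the homogenized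
  ideal. A lifted weight ignores this variable too, so the same subspace serves.\<close>

lemma homogenize_ideal_not_lead:
  assumes "standard_expo g w u" "\<And>f. f \<in> I \<Longrightarrow> eval_cpoly g f = 0" "F \<in> homogenize_ideal I"
  shows "\<not> isolated_lead (lift_weight w) (homogenize_expo d u) F"
proof (rule standard_expo_not_lead)
  let ?g = "case_option 1 g"
  have expo: "eval_expo ?g v = eval_expo g (Poly_Mapping.map_key Some v)" for v
    by (simp add: eval_expo_def prod_UNIV_option map_key.rep_eq)
  have "eval_cpoly ?g (homogenize f) = eval_cpoly g f" for f
    by (simp add: homogenize_def eval_cpoly_sum expo) (simp add: eval_cpoly_def)
  then show "eval_cpoly ?g F = 0"
    using assms(3) unfolding homogenize_ideal_def
    by (rule_tac eval_cpoly_ideal_generated) (auto simp: assms(2))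
  show "standard_expo ?g (lift_weight w) (homogenize_expo d u)"
    using assms(1) unfolding standard_expo_def by (auto simp: expo weight_lift_weight)
qed

section \<open>Rays as cones of the fan\<close>

definition ray :: "'a::real_vector \<Rightarrow> 'a set" where
  "ray v = {t *\<^sub>R v | t. t \<ge> 0}"

lemma ray_memI: "x = t *\<^sub>R v \<Longrightarrow> t \<ge> 0 \<Longrightarrow> x \<in> ray v"
  by (auto simp: ray_def)

lemma ray_eqD:
  assumes "ray v = ray w"
  shows "\<exists>t\<ge>0. v = t *\<^sub>R w"
proof -
  have "v \<in> ray v" by (rule ray_memI[of _ 1]) simp_all
  then show ?thesis unfolding assms by (auto simp: ray_def)
qed

lemma is_ray_ray: "v \<noteq> 0 \<Longrightarrow> is_ray (ray v)"
  by (auto simp: is_ray_def ray_def)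

text \<open>A ray consists of the points that equal their orthogonal projection to the line of
  \<open>v\<close> and have nonnegative inner product with \<open>v\<close>.\<close>

lemma closed_ray: "closed (ray (v :: 'a::euclidean_space))"
proof -
  have "ray v = {x. x = (inverse (v \<bullet> v) * (x \<bullet> v)) *\<^sub>R v} \<inter> {x. 0 \<le> x \<bullet> v}"
  proof (cases "v = 0")
    case False
    then show ?thesis
      by (auto simp: ray_def)
  qed (auto simp: ray_def)
  moreover have "closed {x. x = (inverse (v \<bullet> v) * (x \<bullet> v)) *\<^sub>R v}"
    by (intro closed_Collect_eq continuous_intros)
  moreover have "closed {x. 0 \<le> x \<bullet> v}"
    by (intro closed_Collect_le continuous_intros)
  ultimately show ?thesis by (simp add: closed_Int)
qed

lemma initial_form_scaleR: "s > 0 \<Longrightarrow> initial_form (s *\<^sub>R w) f = initial_form w f"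
  by (simp add: initial_form_def weight_scaleR)

text \<open>The class \<open>D\<close> of the lifted weight contains its positive multiples, and by
  hypothesis \<open>dehom_weight\<close> maps \<open>D\<close> into the ray. Since the ray is
  closed, this persists for the closure of \<open>D\<close>.\<close>

lemma ray_mem_groebner_fan:
  fixes I :: "'v::finite cpoly set"
  assumes cone: "\<And>W. initial_ideal W (homogenize_ideal I) =
      initial_ideal (lift_weight w) (homogenize_ideal I) \<Longrightarrow> \<exists>s>0. dehom_weight W = s *\<^sub>R w"
  shows "ray w \<in> groebner_fan I"
proof -
  define D where "D = {W. initial_ideal W (homogenize_ideal I) =
    initial_ideal (lift_weight w) (homogenize_ideal I)}"
  have pos: "s *\<^sub>R lift_weight w \<in> D" if "s > 0" for s
    using that by (simp add: D_def initial_ideal_def initial_form_scaleR)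
  \<comment> \<open>The origin is obtained only as a limit of positive multiples.\<close>
  have "((\<lambda>s. s *\<^sub>R lift_weight w) \<longlongrightarrow> 0 *\<^sub>R lift_weight w) (at_right 0)"
    by (intro tendsto_intros)
  moreover have "\<forall>\<^sub>F s in at_right 0. s *\<^sub>R lift_weight w \<in> closure D"
    using eventually_at_right_less[of "0::real"]
    by eventually_elim (use pos closure_subset in blast)
  ultimately have "0 *\<^sub>R lift_weight w \<in> closure D"
    by (rule_tac Lim_in_closed_set[of "closure D" _ "at_right 0"]) auto
  then have sup: "s *\<^sub>R lift_weight w \<in> closure D" if "s \<ge> 0" for s
    using that pos[of s] closure_subset[of D] by (cases "s = 0") auto
  have "continuous_on UNIV (dehom_weight :: _ \<Rightarrow> real ^ 'v)"
    unfolding dehom_weight_def by (intro continuous_intros)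
  then have "closed (dehom_weight -` ray w)"
    by (intro closed_vimage closed_ray) 
  moreover have "D \<subseteq> dehom_weight -` ray w"
  proof
    fix W
    assume "W \<in> D"
    then obtain s where "s > 0" "dehom_weight W = s *\<^sub>R w"
      using cone unfolding D_def by blast
    then show "W \<in> dehom_weight -` ray w"
      by (auto simp: ray_def intro: less_imp_le)
  qed
  ultimately have sub: "closure D \<subseteq> dehom_weight -` ray w"
    by (rule closure_minimal[rotated])
  have "ray w = {v. lift_weight v \<in> closure D}"
  proof
    show "ray w \<subseteq> {v. lift_weight v \<in> closure D}"
      using sup by (auto simp: ray_def lift_weight_scaleR)
    show "{v. lift_weight v \<in> closure D} \<subseteq> ray w"
      using sub by force
  qed
  then show ?thesis
    unfolding groebner_fan_def groebner_fan_homogeneous_def D_def by blast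
qed

text \<open>The first assumption on \<open>w'\<close> expresses that the \<open>w'\<close>-homogeneous components of the initial
  forms for \<open>w\<close> are in the initial ideal; \<open>h\<close> separates \<open>w\<close> from its nonpositive multiples.\<close>

lemma ray_mem_groebner_fan_standard:
  fixes I :: "'v::finite cpoly set"
  assumes eval: "\<And>f. f \<in> I \<Longrightarrow> eval_cpoly g f = 0"
    and line: "\<And>w'. (\<And>f u. f \<in> I \<Longrightarrow> u \<in> keys (initial_form w f) \<Longrightarrow> standard_expo g w u \<Longrightarrow>
        \<exists>v\<in>keys (initial_form w f). v \<noteq> u \<and> weight w' v = weight w' u) \<Longrightarrow> \<exists>s. w' = s *\<^sub>R w"
    and h: "h \<in> I" "u0 \<in> keys h" "standard_expo g w u0"
      "\<And>v. v \<in> keys h \<Longrightarrow> v \<noteq> u0 \<Longrightarrow> weight w v < weight w u0"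
  shows "ray w \<in> groebner_fan I"
proof (rule ray_mem_groebner_fan)
  fix W
  assume eq: "initial_ideal W (homogenize_ideal I) =
    initial_ideal (lift_weight w) (homogenize_ideal I)"
  note lead = homogenize_ideal_not_lead[OF _ eval]
  have "\<exists>s. dehom_weight W = s *\<^sub>R w"
  \<comment> \<open>If no other term of the initial form shared the
    \<open>dehom_weight W\<close>-weight of \<open>u\<close>, the transfer between the equal initial
    ideals would make the standard exponent \<open>u\<close> a lead.\<close>
  proof (rule line, rule ccontr)
    fix f u
    assume f: "f \<in> I" "u \<in> keys (initial_form w f)" "standard_expo g w u"
      and *: "\<not> (\<exists>v\<in>keys (initial_form w f). v \<noteq> u \<and>
        weight (dehom_weight W) v = weight (dehom_weight W) u)"
    let ?h = "homogenize_expo (total_degree f)"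
    have "\<exists>F\<in>homogenize_ideal I. isolated_lead (lift_weight w) (?h u) F"
      unfolding homogenize_ideal_def
    proof (rule initial_ideal_eq_isolated_lead'[OF eq[unfolded homogenize_ideal_def]])
      show "homogenize f \<in> ideal_generated (homogenize ` I)"
        using f(1) homogenize_mem unfolding homogenize_ideal_def by blast
      show "?h u \<in> keys (initial_form (lift_weight w) (homogenize f))"
        using f(2) by (simp add: keys_initial_form_homogenize)
      show "weight W v \<noteq> weight W (?h u)"
        if v: "v \<in> keys (initial_form (lift_weight w) (homogenize f))" "v \<noteq> ?h u" for v
      proof -
        obtain v' where v': "v = ?h v'" "v' \<in> keys (initial_form w f)"
          using v(1) by (auto simp: keys_initial_form_homogenize)
        then have "weight (dehom_weight W) v' \<noteq> weight (dehom_weight W) u"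
          using * v(2) by auto
        moreover have "u \<in> keys f" "v' \<in> keys f"
          using f(2) v'(2) by (simp_all add: keys_initial_form)
        ultimately show ?thesis
          by (simp add: v'(1) weight_homogenize_expo expo_degree_le_total_degree)
      qed
    qed
    then show False using lead[OF f(3)] by blast
  qed
  then obtain s where s: "dehom_weight W = s *\<^sub>R w" by blast
  \<comment> \<open>For \<open>s \<le> 0\<close> the term \<open>u0\<close>, of largest
    \<open>w\<close>-weight in \<open>h\<close>, would occur in the initial form for
    \<open>W\<close>. As no other term of \<open>h\<close> has its \<open>w\<close>-weight, the
    transfer would make it a lead for \<open>w\<close>.\<close>
  have "s > 0"
  proof (rule ccontr)
    assume "\<not> s > 0"
    let ?h = "homogenize_expo (total_degree h)"
    have le: "weight w v \<le> weight w u0" if "v \<in> keys h" for v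
      using h(4)[OF that] by force
    have "\<exists>F\<in>homogenize_ideal I. isolated_lead (lift_weight w) (?h u0) F"
      unfolding homogenize_ideal_def
    proof (rule initial_ideal_eq_isolated_lead[OF eq[unfolded homogenize_ideal_def]])
      show "homogenize h \<in> ideal_generated (homogenize ` I)"
        using h(1) homogenize_mem unfolding homogenize_ideal_def by blast
      show "?h u0 \<in> keys (initial_form W (homogenize h))"
      proof -
        have "u0 \<in> keys (initial_form (dehom_weight W) h)"
          using h(2) le \<open>\<not> s > 0\<close>
          by (auto simp: keys_initial_form s weight_scaleR intro: mult_left_mono_neg)
        then show ?thesis by (simp add: keys_initial_form_homogenize)
      qed
      show "weight (lift_weight w) v \<noteq> weight (lift_weight w) (?h u0)"
        if v: "v \<in> keys (initial_form W (homogenize h))" "v \<noteq> ?h u0" for v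
      proof -
        obtain v' where "v = ?h v'" "v' \<in> keys h"
          using v(1) unfolding keys_initial_form_homogenize by (auto simp: keys_initial_form)
        then show ?thesis
          using h(4)[of v'] v(2) by (auto simp: weight_lift_weight)
      qed
    qed
    then show False using lead[OF h(3)] by blast
  qed
  then show "\<exists>s>0. dehom_weight W = s *\<^sub>R w" using s by blast
qed

subsection \<open>Polynomials in three variables\<close>

definition xyz :: "nat \<Rightarrow> nat \<Rightarrow> nat \<Rightarrow> 3 expo" where
  "xyz j k l = Poly_Mapping.single 1 j + Poly_Mapping.single 2 k + Poly_Mapping.single 3 l"

lemma lookup_xyz [simp]:
  "lookup (xyz j k l) 1 = j" "lookup (xyz j k l) 2 = k" "lookup (xyz j k l) 3 = l"
  by (simp_all add: xyz_def lookup_add lookup_single when_def)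

lemma xyz_eq_iff [simp]: "xyz j k l = xyz j' k' l' \<longleftrightarrow> j = j' \<and> k = k' \<and> l = l'"
  by (metis lookup_xyz)

lemma xyz_lookup: "xyz (lookup u 1) (lookup u 2) (lookup u 3) = u"
proof (rule poly_mapping_eqI)
  fix i :: 3
  show "lookup (xyz (lookup u 1) (lookup u 2) (lookup u 3)) i = lookup u i"
    using exhaust_3[of i] by auto
qed

lemma xyz_cases: obtains j k l where "u = xyz j k l"
  by (metis xyz_lookup)

lemma xyz_add: "xyz j k l + xyz j' k' l' = xyz (j + j') (k + k') (l + l')"
  by (simp add: xyz_def single_add ac_simps)

lemma xyz_0: "xyz 0 0 0 = 0"
  by (simp add: xyz_def)

lemma cpoly_eqI_xyz: "(\<And>j k l. lookup f (xyz j k l) = lookup h (xyz j k l)) \<Longrightarrow> f = h"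
  by (rule poly_mapping_eqI) (metis xyz_lookup)

lemma weight_xyz [simp]: "weight w (xyz j k l) = w $ 1 * real j + w $ 2 * real k + w $ 3 * real l"
  by (simp add: weight_def sum_3)

lemma prod_UNIV_3: "prod h (UNIV :: 3 set) = h 1 * h 2 * h 3"
  unfolding UNIV_3 by (simp add: mult.assoc)

lemma eval_expo_xyz: "eval_expo g (xyz j k l) = g 1 ^ j * g 2 ^ k * g 3 ^ l"
  by (simp add: eval_expo_def prod_UNIV_3)

lemma Var_xyz: "Var 1 = Poly_Mapping.single (xyz 1 0 0) 1" "Var 2 = Poly_Mapping.single (xyz 0 1 0) 1"
  "Var 3 = Poly_Mapping.single (xyz 0 0 1) 1"
  by (simp_all add: Var_def xyz_def)

lemma lookup_single_mult_xyz:
  fixes f :: "3 cpoly"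
  shows "lookup (Poly_Mapping.single (xyz a b c) e * f) (xyz j k l) =
    (if a \<le> j \<and> b \<le> k \<and> c \<le> l then e * lookup f (xyz (j - a) (k - b) (l - c)) else 0)"
proof (cases "a \<le> j \<and> b \<le> k \<and> c \<le> l")
  case True
  then have "xyz j k l = xyz a b c + xyz (j - a) (k - b) (l - c)" by (simp add: xyz_add)
  then have "lookup (Poly_Mapping.single (xyz a b c) e * f) (xyz j k l) =
      e * lookup f (xyz (j - a) (k - b) (l - c))"
    using lookup_single_mult[of "xyz a b c" e f] by metis
  then show ?thesis using True by simp
next
  case False
  have "xyz j k l \<noteq> xyz a b c + u" for u
    using False by (cases u rule: xyz_cases) (auto simp: xyz_add)
  then show ?thesis using False lookup_single_mult_eq_0[of "xyz j k l" "xyz a b c" e f] by auto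
qed

section \<open>Polynomials in z, and polynomials linear in x and y\<close>

definition zpoly :: "complex poly \<Rightarrow> 3 cpoly" where
  "zpoly P = (\<Sum>l\<le>degree P. Poly_Mapping.single (xyz 0 0 l) (coeff P l))"

lemma lookup_zpoly: "lookup (zpoly P) (xyz j k l) = (if j = 0 \<and> k = 0 then coeff P l else 0)"
  by (auto simp: zpoly_def lookup_sum lookup_single when_def coeff_eq_0)

lemma lookup_const: "lookup (Poly_Mapping.single 0 a) (xyz j k l) = (if j = 0 \<and> k = 0 \<and> l = 0 then a else 0)"
  by (auto simp flip: xyz_0 simp: lookup_single when_def)

lemma zpoly_pCons: "zpoly (pCons a P) = Poly_Mapping.single 0 a + Var 3 * zpoly P"
  by (rule cpoly_eqI_xyz)
     (simp add: lookup_add lookup_zpoly lookup_const Var_xyz lookup_single_mult_xyz coeff_pCons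
        split: nat.split)

lemma zpoly_0 [simp]: "zpoly 0 = 0"
  by (rule cpoly_eqI_xyz) (simp add: lookup_zpoly)

lemma zpoly_add: "zpoly (P + Q) = zpoly P + zpoly Q"
  by (rule cpoly_eqI_xyz) (simp add: lookup_add lookup_zpoly)

lemma zpoly_uminus: "zpoly (- P) = - zpoly P"
  by (rule cpoly_eqI_xyz) (simp add: lookup_zpoly)

lemma zpoly_smult: "zpoly (smult a P) = Poly_Mapping.single 0 a * zpoly P"
  by (rule cpoly_eqI_xyz) (simp flip: xyz_0 add: lookup_zpoly lookup_single_mult_xyz)

lemma zpoly_mult: "zpoly (P * Q) = zpoly P * zpoly Q"
  by (induction P) (simp_all add: zpoly_add zpoly_smult zpoly_pCons algebra_simps)

lemma zpoly_1 [simp]: "zpoly 1 = 1"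
  by (simp add: one_pCons zpoly_pCons)

lemma zpoly_power: "zpoly (P ^ n) = zpoly P ^ n"
  by (induction n) (simp_all add: zpoly_mult)

lemma zpoly_linear: "zpoly [:1, 1:] = Var 3 + 1" "zpoly [:- 1, 1:] = Var 3 - 1"
  by (simp_all add: zpoly_pCons single_uminus)

definition linear_xy :: "complex poly \<Rightarrow> complex poly \<Rightarrow> complex poly \<Rightarrow> 3 cpoly" where
  "linear_xy A B C = Var 1 * zpoly A + Var 2 * zpoly B + zpoly C"

lemma keys_linear_xy:
  "keys (linear_xy A B C) = {xyz 1 0 l | l. coeff A l \<noteq> 0} \<union> {xyz 0 1 l | l. coeff B l \<noteq> 0} \<union>
    {xyz 0 0 l | l. coeff C l \<noteq> 0}" (is "?L = ?R")
proof (rule set_eqI)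
  fix u
  show "u \<in> ?L \<longleftrightarrow> u \<in> ?R"
    by (cases u rule: xyz_cases)
       (auto simp: in_keys_iff linear_xy_def lookup_add lookup_zpoly Var_xyz lookup_single_mult_xyz)
qed

text \<open>Eliminating \<open>C\<close> by the relation leaves \<open>A\<close> times the first
  generator plus \<open>B\<close> times the second.\<close>

lemma linear_xy_mem_curve_ideal:
  assumes "A * [:1, 1:] ^ (p + 2) + B * [:- 1, 1:] ^ p + C = 0"
  shows "linear_xy A B C \<in> curve_ideal p"
proof -
  have C: "C = - (A * [:1, 1:] ^ (p + 2) + B * [:- 1, 1:] ^ p)"
    using assms by (simp only: eq_neg_iff_add_eq_0 add.commute)
  have "linear_xy A B C = zpoly A * (Var 1 - (Var 3 + 1) ^ (p + 2)) + zpoly B * (Var 2 - (Var 3 - 1) ^ p)"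
    unfolding linear_xy_def C zpoly_uminus zpoly_add zpoly_mult zpoly_power zpoly_linear
    by (simp add: algebra_simps)
  also have "\<dots> \<in> curve_ideal p"
    unfolding curve_ideal_def Let_def
    by (intro ideal_generated_add ideal_generated_mult ideal_generated_base) auto
  finally show ?thesis .
qed

section \<open>The parametrization of the curve, with its orders of vanishing and degrees\<close>

definition curve_param :: "nat \<Rightarrow> 3 \<Rightarrow> complex poly" where
  "curve_param p i = (if i = 1 then [:1, 1:] ^ (p + 2) else if i = 2 then [:- 1, 1:] ^ p else [:0, 1:])"

lemma curve_param_simps [simp]:
  "curve_param p 1 = [:1, 1:] ^ (p + 2)" "curve_param p 2 = [:- 1, 1:] ^ p"
  "curve_param p 3 = [:0, 1:]"
  by (simp_all add: curve_param_def)

lemma curve_param_nonzero: "curve_param p i \<noteq> 0"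
  by (simp add: curve_param_def del: power_Suc)

lemma eval_curve_ideal:
  assumes "f \<in> curve_ideal p"
  shows "eval_cpoly (curve_param p) f = 0"
proof (rule eval_cpoly_ideal_generated)
  show "f \<in> ideal_generated {Var 1 - (Var 3 + 1) ^ (p + 2), Var 2 - (Var 3 - 1) ^ p}"
    using assms by (simp only: curve_ideal_def Let_def)
  show "eval_cpoly (curve_param p) h = 0"
    if "h \<in> {Var 1 - (Var 3 + 1) ^ (p + 2), Var 2 - (Var 3 - 1) ^ p}" for h
    using that
    by (auto simp: eval_cpoly_diff eval_cpoly_add eval_cpoly_power one_pCons simp del: power_Suc)
qed

lemma order_power: "q \<noteq> 0 \<Longrightarrow> order c (q ^ n) = n * order c (q :: complex poly)"
  by (induction n) (simp_all add: order_mult)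

lemma eval_expo_nonzero: "(\<And>i. g i \<noteq> 0) \<Longrightarrow> eval_expo g u \<noteq> 0"
  by (simp add: eval_expo_def)

lemma order_eval_expo:
  assumes "\<And>i. g i \<noteq> 0"
  shows "order c (eval_expo g u) = (\<Sum>i\<in>UNIV. lookup u i * order c (g i))"
proof -
  have "order c (\<Prod>i\<in>A. g i ^ lookup u i) = (\<Sum>i\<in>A. lookup u i * order c (g i))" if "finite A" for A
    using that by induction (simp_all add: order_mult order_power assms)
  then show ?thesis by (simp add: eval_expo_def)
qed

lemma degree_eval_expo:
  assumes "\<And>i. g i \<noteq> 0"
  shows "degree (eval_expo g u) = (\<Sum>i\<in>UNIV. lookup u i * degree (g i))"
proof -
  have "degree (\<Prod>i\<in>A. g i ^ lookup u i) = (\<Sum>i\<in>A. lookup u i * degree (g i))" if "finite A" for A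
    using that by induction (simp_all add: degree_mult_eq degree_power_eq assms)
  then show ?thesis by (simp add: eval_expo_def)
qed

text \<open>The weight of a monomial is here a multiple of the order of its value at
  \<open>c\<close>. The polynomials vanishing at \<open>c\<close> to higher order than the value of
  \<open>u\<close> form the required subspace. The case \<open>s = 0\<close> covers the
  origin.\<close>

lemma standard_expo_order:
  assumes g: "\<And>i. g i \<noteq> 0" and w: "\<And>i. w $ i = s * real (order c (g i))" and "s \<ge> 0"
  shows "standard_expo g w u"
  unfolding standard_expo_def
proof (intro exI conjI allI impI)
  let ?V = "{q. [:- c, 1:] ^ Suc (order c (eval_expo g u)) dvd q}"
  show "poly_subspace ?V"
    by (auto simp: poly_subspace_def dvd_smult simp del: power_Suc)
  show "eval_expo g u \<notin> ?V"
    using eval_expo_nonzero[of g u] g by (simp add: order_divides del: power_Suc)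
  have weight: "weight w v = s * real (order c (eval_expo g v))" for v
    by (simp add: weight_def w order_eval_expo[OF g] sum_distrib_left mult_ac)
  show "eval_expo g v \<in> ?V" if "weight w u < weight w v" for v
  proof -
    have "order c (eval_expo g u) < order c (eval_expo g v)"
      using that \<open>s \<ge> 0\<close> unfolding weight by (metis linorder_not_less mult_left_mono of_nat_le_iff)
    then show ?thesis by (simp add: order_divides del: power_Suc)
  qed
qed

text \<open>The analogue at infinity, where the subspace consists of the polynomials of smaller
  degree than the value of \<open>u\<close>.\<close>

lemma standard_expo_degree:
  assumes g: "\<And>i. g i \<noteq> 0" and w: "\<And>i. w $ i = - s * real (degree (g i))" and "s \<ge> 0"
  shows "standard_expo g w u"
  unfolding standard_expo_def
proof (intro exI conjI allI impI)
  let ?V = "{q. \<forall>l\<ge>degree (eval_expo g u). coeff q l = 0}"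
  show "poly_subspace ?V"
    by (auto simp: poly_subspace_def)
  show "eval_expo g u \<notin> ?V"
    using eval_expo_nonzero[of g u] g by auto
  have weight: "weight w v = - s * real (degree (eval_expo g v))" for v
    by (simp add: weight_def w degree_eval_expo[OF g] sum_distrib_left mult_ac sum_negf)
  show "eval_expo g v \<in> ?V" if "weight w u < weight w v" for v
  proof -
    have "degree (eval_expo g v) < degree (eval_expo g u)"
      using that \<open>s \<ge> 0\<close> unfolding weight
      by (metis linorder_not_less minus_mult_left mult_left_mono neg_le_iff_le of_nat_le_iff)
    then show ?thesis by (auto intro: coeff_eq_0)
  qed
qed

subsection \<open>The tropical variety\<close>

lemma vec3_eq_iff: "v = w \<longleftrightarrow> v $ 1 = w $ 1 \<and> v $ 2 = w $ 2 \<and> v $ 3 = (w $ 3 :: real)" for v w :: "real ^ 3"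
  by (simp add: vec_eq_iff forall_3)

lemma coeff_1_eq: "coeff (1 :: complex poly) l \<noteq> 0 \<longleftrightarrow> l = 0"
  by (simp add: coeff_1)

text \<open>Binomial coefficients are nonzero in characteristic 0, so the powers in both generators
  contain every power of z up to their degree.\<close>

lemma coeff_linear_poly_power_nonzero:
  "coeff ([:a, 1:] ^ n) l \<noteq> 0 \<longleftrightarrow> l \<le> n" if "a \<noteq> (0 :: complex)"
proof (cases "l \<le> n")
  case True
  then show ?thesis using that by (simp add: coeff_linear_poly_power)
next
  case False
  then show ?thesis by (simp add: coeff_eq_0 degree_power_eq)
qed

definition generator_x :: "nat \<Rightarrow> 3 cpoly" where
  "generator_x p = linear_xy 1 0 (- ([:1, 1:] ^ (p + 2)))"

definition generator_y :: "nat \<Rightarrow> 3 cpoly" where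
  "generator_y p = linear_xy 0 1 (- ([:- 1, 1:] ^ p))"

lemma generator_x_mem: "generator_x p \<in> curve_ideal p"
  unfolding generator_x_def by (rule linear_xy_mem_curve_ideal) (simp del: power_Suc)

lemma generator_y_mem: "generator_y p \<in> curve_ideal p"
  unfolding generator_y_def by (rule linear_xy_mem_curve_ideal) simp

lemma keys_generator_x: "keys (generator_x p) = insert (xyz 1 0 0) (xyz 0 0 ` {..p + 2})"
  unfolding generator_x_def keys_linear_xy coeff_minus neg_equal_0_iff_equal coeff_1_eq
  by (subst coeff_linear_poly_power_nonzero) (auto simp del: power_Suc)

lemma keys_generator_y: "keys (generator_y p) = insert (xyz 0 1 0) (xyz 0 0 ` {..p})"
  unfolding generator_y_def keys_linear_xy coeff_minus neg_equal_0_iff_equal coeff_1_eq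
  by (subst coeff_linear_poly_power_nonzero) auto

text \<open>Among the powers of z, the lowest weight is attained only at the constant term or only
  at \<open>z ^ n\<close>, according to the sign of \<open>w $ 3\<close>, and \<open>m\<close> must
  tie with it. For \<open>w $ 3 = 0\<close> they all have weight 0, and \<open>m\<close> must not
  lie below.\<close>

lemma no_isolated_lead_weights:
  assumes keys: "keys f = insert m (xyz 0 0 ` {..n})" and m: "m \<notin> xyz 0 0 ` {..n}"
    and no: "\<And>u. \<not> isolated_lead w u f"
  shows "w $ 3 > 0 \<Longrightarrow> weight w m = 0" "w $ 3 < 0 \<Longrightarrow> weight w m = real n * w $ 3"
    "w $ 3 = 0 \<Longrightarrow> weight w m \<ge> 0"
proof -
  show "weight w m = 0" if "w $ 3 > 0"
  proof (rule ccontr)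
    assume "weight w m \<noteq> 0"
    then consider "weight w m < 0" | "weight w m > 0" by linarith
    then show False
    proof cases
      case 1
      have "weight w m < w $ 3 * real l" for l
        using 1 that mult_nonneg_nonneg[of "w $ 3" "real l"] by linarith
      then have "isolated_lead w m f"
        unfolding isolated_lead_def keys by auto
      then show ?thesis using no by blast
    next
      case 2
      have "isolated_lead w (xyz 0 0 0) f"
        using 2 that unfolding isolated_lead_def keys by auto
      then show ?thesis using no by blast
    qed
  qed
  show "weight w m = real n * w $ 3" if "w $ 3 < 0"
  proof (rule ccontr)
    assume "weight w m \<noteq> real n * w $ 3"
    have le: "real n * w $ 3 \<le> w $ 3 * real l" if "l \<le> n" for l
      using \<open>w $ 3 < 0\<close> that by (simp add: mult.commute)
    have less: "real n * w $ 3 < w $ 3 * real l" if "l < n" for l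
      using \<open>w $ 3 < 0\<close> that by (simp add: mult.commute)
    from \<open>weight w m \<noteq> real n * w $ 3\<close>
    consider "weight w m < real n * w $ 3" | "weight w m > real n * w $ 3" by linarith
    then show False
    proof cases
      case 1
      then have "isolated_lead w m f"
        using le unfolding isolated_lead_def keys by (force intro: less_le_trans)
      then show ?thesis using no by blast
    next
      case 2
      have "isolated_lead w (xyz 0 0 n) f"
        using 2 less unfolding isolated_lead_def keys by (auto simp: mult.commute)
      then show ?thesis using no by blast
    qed
  qed
  show "weight w m \<ge> 0" if "w $ 3 = 0"
    using no[of m] that unfolding isolated_lead_def keys by force
qed

lemma curve_ideal_tropical_iff:
  "w \<in> tropical_variety (curve_ideal p) \<longleftrightarrow> (\<nexists>f u. f \<in> curve_ideal p \<and> isolated_lead w u f)"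
  unfolding curve_ideal_def Let_def by (rule tropical_variety_iff)

lemma initial_form_single_plus:
  assumes "h \<noteq> 0" and h: "\<And>v. v \<in> keys h \<Longrightarrow> weight w v = e" and m: "e < weight w m"
  shows "initial_form w (Poly_Mapping.single m c + h) = h"
proof (rule poly_mapping_eqI)
  fix u
  let ?f = "Poly_Mapping.single m c + h"
  have "m \<notin> keys h" using h[of m] m by auto
  have f: "lookup ?f v = lookup h v" if "v \<noteq> m" for v
    using that by (simp add: lookup_add lookup_single_not_eq)
  obtain v where v: "v \<in> keys h" using \<open>h \<noteq> 0\<close> by fastforce
  then have v': "v \<in> keys ?f" using f[of v] \<open>m \<notin> keys h\<close> by (metis in_keys_iff)
  show "lookup (initial_form w ?f) u = lookup h u"
  proof (cases "u \<in> keys h")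
    case True
    have "weight w u \<le> weight w v" if "v \<in> keys ?f" for v
      using that h[OF True] h[of v] m f[of v] by (cases "v = m") (auto simp: in_keys_iff)
    then show ?thesis
      using True f[of u] \<open>m \<notin> keys h\<close> by (auto simp: lookup_initial_form)
  next
    case False
    have "lookup (initial_form w ?f) u = 0"
    proof (cases "u = m")
      case True
      then show ?thesis using v' h[OF v] m by (force simp: lookup_initial_form)
    next
      case False
      then show ?thesis using f[of u] \<open>u \<notin> keys h\<close> by (simp add: lookup_initial_form in_keys_iff)
    qed
    then show ?thesis using False by (simp add: in_keys_iff)
  qed
qed

lemma weight_keys_zpoly: "w $ 3 = 0 \<Longrightarrow> v \<in> keys (zpoly C) \<Longrightarrow> weight w v = 0"
  by (cases v rule: xyz_cases) (auto simp: in_keys_iff lookup_zpoly split: if_splits)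

lemma zpoly_eq_0_iff: "zpoly C = 0 \<longleftrightarrow> C = 0"
proof
  assume "zpoly C = 0"
  then show "C = 0"
    by (intro poly_eqI) (metis coeff_0 lookup_zero lookup_zpoly)
qed simp

text \<open>This is the case that needs both generators at once: their initial forms are, up to
  sign, the coprime polynomials (z + 1)^(p+2) and (z - 1)^p, so 1 lies in the initial ideal.\<close>

lemma tropical_not_both_pos:
  assumes w: "w \<in> tropical_variety (curve_ideal p)" and "w $ 3 = 0" "w $ 1 > 0" "w $ 2 > 0"
  shows False
proof -
  let ?J = "initial_ideal w (curve_ideal p)"
  let ?X = "- ([:1, 1:] ^ (p + 2)) :: complex poly" and ?Y = "- ([:- 1, 1:] ^ p) :: complex poly"
  have "generator_x p = Poly_Mapping.single (xyz 1 0 0) 1 + zpoly ?X"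
    by (simp add: generator_x_def linear_xy_def Var_xyz del: power_Suc)
  moreover have "initial_form w \<dots> = zpoly ?X"
    by (rule initial_form_single_plus[of _ _ 0])
       (use assms in \<open>auto simp: zpoly_eq_0_iff weight_keys_zpoly simp del: power_Suc\<close>)
  ultimately have X: "zpoly ?X \<in> ?J"
    using initial_form_mem[OF generator_x_mem] by metis
  have "generator_y p = Poly_Mapping.single (xyz 0 1 0) 1 + zpoly ?Y"
    by (simp add: generator_y_def linear_xy_def Var_xyz)
  moreover have "initial_form w \<dots> = zpoly ?Y"
    by (rule initial_form_single_plus[of _ _ 0])
       (use assms in \<open>auto simp: zpoly_eq_0_iff weight_keys_zpoly\<close>)
  ultimately have Y: "zpoly ?Y \<in> ?J"
    using initial_form_mem[OF generator_y_mem] by metis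
  have "[:1 / 2:] * [:1, 1:] + [:- 1 / 2:] * [:- 1, 1 :: complex:] = 1"
    by (simp add: one_pCons)
  from bezout_powers[OF this, of "p + 2" p]
  obtain u v :: "complex poly" where "u * [:1, 1:] ^ (p + 2) + v * [:- 1, 1:] ^ p = 1" by (elim exE)
  then have "1 = (- u) * ?X + (- v) * ?Y" by (simp only: minus_mult_minus)
  then have "zpoly 1 = zpoly ((- u) * ?X + (- v) * ?Y)"
    by (rule arg_cong)
  also have "\<dots> = zpoly (- u) * zpoly ?X + zpoly (- v) * zpoly ?Y"
    by (simp only: zpoly_add zpoly_mult)
  finally have "zpoly 1 = zpoly (- u) * zpoly ?X + zpoly (- v) * zpoly ?Y" .
  moreover have "zpoly (- u) * zpoly ?X + zpoly (- v) * zpoly ?Y \<in> ?J"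
    using X Y unfolding initial_ideal_def by (intro ideal_generated_add ideal_generated_mult)
  ultimately have "Poly_Mapping.single 0 1 \<in> ?J"
    by (simp only: zpoly_1 single_one)
  moreover have "is_monomial (Poly_Mapping.single 0 1 :: 3 cpoly)"
    unfolding is_monomial_def by (intro exI[of _ 0] exI[of _ 1]) simp
  ultimately show False
    using w unfolding tropical_variety_def by blast
qed

text \<open>The entries are the negated degrees of the coordinates of the parametrization.\<close>

definition ray_at_infinity :: "nat \<Rightarrow> real ^ 3" where
  "ray_at_infinity p = vector [- real (p + 2), - real p, - 1]"

lemma degree_curve_param:
  "degree (curve_param p 1) = p + 2" "degree (curve_param p 2) = p" "degree (curve_param p 3) = 1"
  by (simp_all add: degree_power_eq del: power_Suc)

lemma order_curve_param:
  "order (- 1) (curve_param p 1) = p + 2" "order (- 1) (curve_param p 2) = 0"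
  "order (- 1) (curve_param p 3) = 0"
  "order 1 (curve_param p 1) = 0" "order 1 (curve_param p 2) = p" "order 1 (curve_param p 3) = 0"
  "order 0 (curve_param p 1) = 0" "order 0 (curve_param p 2) = 0" "order 0 (curve_param p 3) = 1"
  using order_power_n_n[of "- 1 :: complex" "p + 2"] order_power_n_n[of "1 :: complex" p]
    order_power_n_n[of "0 :: complex" 1]
  by (auto intro!: order_0I simp: poly_power simp del: power_Suc)

lemma standard_expo_curve_order:
  assumes "s \<ge> 0" "w $ 1 = s * real (order c (curve_param p 1))"
    "w $ 2 = s * real (order c (curve_param p 2))" "w $ 3 = s * real (order c (curve_param p 3))"
  shows "standard_expo (curve_param p) w u"
proof (rule standard_expo_order)
  show "w $ i = s * real (order c (curve_param p i))" for i
    using exhaust_3[of i] assms by (elim disjE) simp_all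
qed (use assms in \<open>simp_all add: curve_param_nonzero\<close>)

lemma standard_expo_curve_degree:
  assumes "s \<ge> 0" "w $ 1 = - s * real (p + 2)" "w $ 2 = - s * real p" "w $ 3 = - s"
  shows "standard_expo (curve_param p) w u"
proof (rule standard_expo_degree)
  show "w $ i = - s * real (degree (curve_param p i))" for i
    using exhaust_3[of i] assms degree_curve_param[of p] by (elim disjE) (simp_all del: curve_param_simps)
qed (use assms in \<open>simp_all add: curve_param_nonzero\<close>)

lemma tropical_variety_curve_ideal:
  assumes "p \<ge> 1"
  shows "tropical_variety (curve_ideal p) =
    ray (vector [1, 0, 0]) \<union> ray (vector [0, 1, 0]) \<union> ray (vector [0, 0, 1]) \<union> ray (ray_at_infinity p)"
    (is "_ = ?R")
proof
  show "tropical_variety (curve_ideal p) \<subseteq> ?R"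
  proof
    fix w
    assume w: "w \<in> tropical_variety (curve_ideal p)"
    then have no: "\<not> isolated_lead w u (generator_x p)" "\<not> isolated_lead w u (generator_y p)" for u
      using generator_x_mem generator_y_mem unfolding curve_ideal_tropical_iff by blast+
    have "xyz 1 0 0 \<notin> xyz 0 0 ` A" "xyz 0 1 0 \<notin> xyz 0 0 ` A" for A
      by auto
    note x = no_isolated_lead_weights[OF keys_generator_x this(1) no(1)]
      and y = no_isolated_lead_weights[OF keys_generator_y this(2) no(2)]
    consider "w $ 3 > 0" | "w $ 3 < 0" | "w $ 3 = 0" by linarith
    then show "w \<in> ?R"
    proof cases
      case 1
      then have "w = w $ 3 *\<^sub>R vector [0, 0, 1]"
        using x y by (simp add: vec3_eq_iff)
      then have "w \<in> ray (vector [0, 0, 1])"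
        by (rule ray_memI) (use 1 in simp)
      then show ?thesis by blast
    next
      case 2
      then have "w = (- w $ 3) *\<^sub>R ray_at_infinity p"
        using x y by (simp add: vec3_eq_iff ray_at_infinity_def algebra_simps)
      then have "w \<in> ray (ray_at_infinity p)"
        by (rule ray_memI) (use 2 in simp)
      then show ?thesis by blast
    next
      case 3
      then have "w $ 1 \<ge> 0" "w $ 2 \<ge> 0" using x y by auto
      moreover have "w $ 1 = 0 \<or> w $ 2 = 0"
        using tropical_not_both_pos[OF w 3] calculation by (metis less_eq_real_def)
      ultimately have "w = w $ 2 *\<^sub>R vector [0, 1, 0] \<and> w $ 2 \<ge> 0 \<or>
          w = w $ 1 *\<^sub>R vector [1, 0, 0] \<and> w $ 1 \<ge> 0"
        using 3 by (auto simp: vec3_eq_iff)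
      then have "w \<in> ray (vector [0, 1, 0]) \<union> ray (vector [1, 0, 0])"
        unfolding ray_def by blast
      then show ?thesis by blast
    qed
  qed
  have sub: "ray v \<subseteq> tropical_variety (curve_ideal p)"
    if "\<And>t u. t \<ge> 0 \<Longrightarrow> standard_expo (curve_param p) (t *\<^sub>R v) u" for v
    using that standard_expo_not_lead eval_curve_ideal
    unfolding ray_def curve_ideal_tropical_iff subset_iff by blast
  \<comment> \<open>The scale is \<open>t\<close> divided by the order of vanishing of the
    coordinate in question. For y this order is \<open>p\<close>, which is positive by
    assumption.\<close>
  have "standard_expo (curve_param p) (t *\<^sub>R vector [1, 0, 0]) u" if "t \<ge> 0" for t u
    by (rule standard_expo_curve_order[of "t / real (p + 2)" _ "- 1"])
       (use that assms in \<open>simp_all add: order_curve_param del: curve_param_simps\<close>)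
  moreover have "standard_expo (curve_param p) (t *\<^sub>R vector [0, 1, 0]) u" if "t \<ge> 0" for t u
    by (rule standard_expo_curve_order[of "t / real p" _ "1"])
       (use that assms in \<open>simp_all add: order_curve_param del: curve_param_simps\<close>)
  moreover have "standard_expo (curve_param p) (t *\<^sub>R vector [0, 0, 1]) u" if "t \<ge> 0" for t u
    by (rule standard_expo_curve_order[of "t" _ "0"])
       (use that assms in \<open>simp_all add: order_curve_param del: curve_param_simps\<close>)
  moreover have "standard_expo (curve_param p) (t *\<^sub>R ray_at_infinity p) u" if "t \<ge> 0" for t u
    by (rule standard_expo_curve_degree[of t]) (use that in \<open>simp_all add: ray_at_infinity_def algebra_simps\<close>)
  ultimately show "?R \<subseteq> tropical_variety (curve_ideal p)"
    using sub by (intro Un_least) blast+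
qed

subsection \<open>Rays of the Groebner fan of the curve\<close>

lemma keys_initial_form_binomial:
  assumes keys: "keys f = insert m (xyz 0 0 ` {..n})" and "k \<le> n"
    and m: "weight w m = w $ 3 * real k"
    and k: "\<And>l. l \<le> n \<Longrightarrow> l \<noteq> k \<Longrightarrow> w $ 3 * real k < w $ 3 * real l"
  shows "keys (initial_form w f) = {m, xyz 0 0 k}"
proof -
  have le: "w $ 3 * real k \<le> w $ 3 * real l" if "l \<le> n" for l
    using k[OF that] by (cases "l = k") auto
  have "l = k" if "l \<le> n" "w $ 3 * real l \<le> w $ 3 * real k" for l
    using k[of l] that by force
  with le show ?thesis
    using \<open>k \<le> n\<close> unfolding keys_initial_form keys by (auto simp: m)
qed

text \<open>All exponents are standard for this weight, so the two terms of each binomial initial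
  form, x with 1 and y with 1, must have equal \<open>w'\<close>-weight. The top power of z serves
  as \<open>u0\<close>.\<close>

lemma ray_z_mem_groebner_fan: "ray (vector [0, 0, 1]) \<in> groebner_fan (curve_ideal p)"
proof (rule ray_mem_groebner_fan_standard[where g = "curve_param p" and h = "generator_x p"
      and ?u0.0 = "xyz 0 0 (p + 2)"])
  let ?w = "vector [0, 0, 1] :: real ^ 3"
  have std: "standard_expo (curve_param p) ?w u" for u
    by (rule standard_expo_curve_order[of 1 _ 0]) (simp_all add: order_curve_param del: curve_param_simps)
  then show "standard_expo (curve_param p) ?w (xyz 0 0 (p + 2))" .
  have x: "keys (initial_form ?w (generator_x p)) = {xyz 1 0 0, xyz 0 0 0}"
    by (rule keys_initial_form_binomial[OF keys_generator_x]) auto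
  have y: "keys (initial_form ?w (generator_y p)) = {xyz 0 1 0, xyz 0 0 0}"
    by (rule keys_initial_form_binomial[OF keys_generator_y]) auto
  fix w'
  assume *: "\<And>f u. f \<in> curve_ideal p \<Longrightarrow> u \<in> keys (initial_form ?w f) \<Longrightarrow>
    standard_expo (curve_param p) ?w u \<Longrightarrow>
    \<exists>v\<in>keys (initial_form ?w f). v \<noteq> u \<and> weight w' v = weight w' u"
  have "w' $ 1 = 0" "w' $ 2 = 0"
    using *[OF generator_x_mem, of "xyz 1 0 0"] *[OF generator_y_mem, of "xyz 0 1 0"] std by (auto simp: x y)
  then have "w' = w' $ 3 *\<^sub>R ?w" by (simp add: vec3_eq_iff)
  then show "\<exists>s. w' = s *\<^sub>R ?w" ..
qed (auto simp: keys_generator_x generator_x_mem eval_curve_ideal)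

text \<open>As for the z-axis, now with x tied to z^(p+2) and y tied to z^p. All weights are
  nonpositive, so the constant term serves as \<open>u0\<close>.\<close>

lemma ray_at_infinity_mem_groebner_fan: "ray (ray_at_infinity p) \<in> groebner_fan (curve_ideal p)"
proof (rule ray_mem_groebner_fan_standard[where g = "curve_param p" and h = "generator_x p"
      and ?u0.0 = "xyz 0 0 0"])
  let ?w = "ray_at_infinity p"
  have std: "standard_expo (curve_param p) ?w u" for u
    by (rule standard_expo_curve_degree[of 1]) (simp_all add: ray_at_infinity_def)
  then show "standard_expo (curve_param p) ?w (xyz 0 0 0)" .
  have x: "keys (initial_form ?w (generator_x p)) = {xyz 1 0 0, xyz 0 0 (p + 2)}"
    by (rule keys_initial_form_binomial[OF keys_generator_x]) (auto simp: ray_at_infinity_def)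
  have y: "keys (initial_form ?w (generator_y p)) = {xyz 0 1 0, xyz 0 0 p}"
    by (rule keys_initial_form_binomial[OF keys_generator_y]) (auto simp: ray_at_infinity_def)
  fix w'
  assume *: "\<And>f u. f \<in> curve_ideal p \<Longrightarrow> u \<in> keys (initial_form ?w f) \<Longrightarrow>
    standard_expo (curve_param p) ?w u \<Longrightarrow>
    \<exists>v\<in>keys (initial_form ?w f). v \<noteq> u \<and> weight w' v = weight w' u"
  have "w' $ 1 = w' $ 3 * real (p + 2)" "w' $ 2 = w' $ 3 * real p"
    using *[OF generator_x_mem, of "xyz 1 0 0"] *[OF generator_y_mem, of "xyz 0 1 0"] std by (auto simp: x y)
  then have "w' = (- w' $ 3) *\<^sub>R ?w"
    by (simp add: vec3_eq_iff ray_at_infinity_def algebra_simps)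
  then show "\<exists>s. w' = s *\<^sub>R ?w" ..
qed (auto simp: keys_generator_x generator_x_mem eval_curve_ideal ray_at_infinity_def)

text \<open>Up to scaling, the weight for which x z^i, y z^(i+2) and z^(p-1-i) tie, with negative
  entry for z. The subtractions are exact for 3i + 5 <= p.\<close>

definition pade_weight :: "nat \<Rightarrow> nat \<Rightarrow> real ^ 3" where
  "pade_weight p i = vector [- real (p - 1 - 2 * i), - real (p - 3 - 2 * i), - 1]"

lemma X_power: "[:0, 1:] ^ n = monom (1 :: complex) n"
  by (simp add: monom_altdef)

text \<open>One statement for the three leading monomials of the Pade relation: each is the value of
  a triple with exactly one nonzero entry. Membership in the subspace of triples of lower degrees
  would give a relation that \<open>pade_normal\<close> excludes.\<close>

lemma pade_standard:
  assumes i: "3 * i + 5 \<le> p"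
    and deg: "degree A \<le> i" "degree B \<le> i + 2" "degree C \<le> p - 1 - i"
    and zero: "coeff A i = 0 \<or> coeff B (i + 2) = 0 \<or> coeff C (p - 1 - i) = 0"
    and nz: "coeff A i \<noteq> 0 \<or> coeff B (i + 2) \<noteq> 0 \<or> coeff C (p - 1 - i) \<noteq> 0"
    and u: "eval_expo (curve_param p) u = A * [:1, 1:] ^ (p + 2) + B * [:- 1, 1:] ^ p + C"
      "weight (pade_weight p i) u = - real (p - 1 - i)"
  shows "standard_expo (curve_param p) (pade_weight p i) u"
  unfolding standard_expo_def
proof (intro exI conjI allI impI)
  \<comment> \<open>This is the condition that the degree is below \<open>d\<close>, in a form that
    for \<open>d = 0\<close> leaves only the zero polynomial; this matters for
    \<open>i = 0\<close>.\<close>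
  define low where "low d P \<longleftrightarrow> (\<forall>l\<ge>d. coeff P l = 0)" for d and P :: "complex poly"
  let ?V = "{A * [:1, 1:] ^ (p + 2) + B * [:- 1, 1:] ^ p + C | A B C.
    low i A \<and> low (i + 2) B \<and> low (p - 1 - i) C}"
  have VI: "q \<in> ?V" if "q = A * [:1, 1:] ^ (p + 2) + B * [:- 1, 1:] ^ p + C"
    "low i A" "low (i + 2) B" "low (p - 1 - i) C" for q A B C
    using that by blast
  have low: "low d 0" "low d P \<Longrightarrow> low d Q \<Longrightarrow> low d (P + Q)" "low d P \<Longrightarrow> low d (smult c P)"
    "low d (monom a n) \<longleftrightarrow> n < d \<or> a = 0" for d P Q c a n
    by (auto simp: low_def coeff_monom)
  show "poly_subspace ?V"
    unfolding poly_subspace_def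
  proof (intro conjI ballI allI)
    show "0 \<in> ?V" by (rule VI[of _ 0 0 0]) (simp_all add: low)
  next
    fix q r assume "q \<in> ?V" "r \<in> ?V"
    then obtain A B C A' B' C'
      where "q = A * [:1, 1:] ^ (p + 2) + B * [:- 1, 1:] ^ p + C"
        "low i A" "low (i + 2) B" "low (p - 1 - i) C"
        "r = A' * [:1, 1:] ^ (p + 2) + B' * [:- 1, 1:] ^ p + C'"
        "low i A'" "low (i + 2) B'" "low (p - 1 - i) C'" by blast
    then show "q + r \<in> ?V"
      by (intro VI[of _ "A + A'" "B + B'" "C + C'"]) (simp_all add: low algebra_simps del: power_Suc)
  next
    fix c q assume "q \<in> ?V"
    then obtain A B C where "q = A * [:1, 1:] ^ (p + 2) + B * [:- 1, 1:] ^ p + C"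
        "low i A" "low (i + 2) B" "low (p - 1 - i) C" by blast
    then show "smult c q \<in> ?V"
      by (intro VI[of _ "smult c A" "smult c B" "smult c C"])
         (simp_all add: low smult_add_right del: power_Suc)
  qed
  show "eval_expo (curve_param p) u \<notin> ?V"
  proof
    assume "eval_expo (curve_param p) u \<in> ?V"
    then obtain A' B' C' where eq: "A * [:1, 1:] ^ (p + 2) + B * [:- 1, 1:] ^ p + C =
        A' * [:1, 1:] ^ (p + 2) + B' * [:- 1, 1:] ^ p + C'"
      and l: "low i A'" "low (i + 2) B'" "low (p - 1 - i) C'"
      unfolding u(1) by blast
    have deg': "degree P \<le> d" if "low d P" for d P
      using that by (intro degree_le) (auto simp: low_def)
    \<comment> \<open>Subtracting low polynomials leaves the three extremal coefficients unchanged,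
      so one of them is still zero, and another one still contradicts triviality.\<close>
    have "A - A' = 0 \<and> B - B' = 0 \<and> C - C' = 0"
    proof (rule pade_normal)
      show "(A - A') * [:1, 1:] ^ (p + 2) + (B - B') * [:- 1, 1:] ^ p + (C - C') = 0"
        using eq by (simp add: algebra_simps del: power_Suc)
      show "degree (A - A') \<le> i" "degree (B - B') \<le> i + 2" "degree (C - C') \<le> p - 1 - i"
        using l deg deg' by (meson degree_diff_le)+
      show "coeff (A - A') i = 0 \<or> coeff (B - B') (i + 2) = 0 \<or> coeff (C - C') (p - 1 - i) = 0"
        using zero l by (auto simp: low_def)
    qed (use i in auto)
    then show False using nz l by (auto simp: low_def)
  qed
  show "eval_expo (curve_param p) v \<in> ?V"
    if less: "weight (pade_weight p i) u < weight (pade_weight p i) v" for v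
  proof (cases v rule: xyz_cases)
    case (1 j k l)
    have "real ((p - 1 - 2 * i) * j + (p - 3 - 2 * i) * k + l) < real (p - 1 - i)"
      using less unfolding u(2) 1 by (simp add: pade_weight_def)
    then have lt: "(p - 1 - 2 * i) * j + (p - 3 - 2 * i) * k + l < p - 1 - i"
      by (simp only: of_nat_less_iff)
    \<comment> \<open>Two factors x or y contribute at least 2(p - 3 - 2i) to the negated weight,
      and this is at least p - 1 - i precisely when 3i + 5 <= p.\<close>
    have "(p - 3 - 2 * i) * (j + k) \<le> (p - 1 - 2 * i) * j + (p - 3 - 2 * i) * k"
      by (simp add: distrib_left diff_le_mono2)
    then have "(p - 3 - 2 * i) * (j + k) < (p - 3 - 2 * i) * 2"
      using lt i by linarith
    then have "j + k < 2" by (simp only: mult_less_cancel1)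
    then consider "j = 0" "k = 0" | "j = 1" "k = 0" | "j = 0" "k = 1" by linarith
    then show ?thesis
    proof cases
      case 1
      then show ?thesis using lt \<open>v = xyz j k l\<close>
        by (intro VI[of _ 0 0 "monom 1 l"]) (auto simp: eval_expo_xyz low X_power simp del: power_Suc)
    next
      case 2
      then show ?thesis using lt i \<open>v = xyz j k l\<close>
        by (intro VI[of _ "monom 1 l" 0 0]) (auto simp: eval_expo_xyz low X_power simp del: power_Suc)
    next
      case 3
      then show ?thesis using lt i \<open>v = xyz j k l\<close>
        by (intro VI[of _ 0 "monom 1 l" 0]) (auto simp: eval_expo_xyz low X_power simp del: power_Suc)
    qed
  qed
qed

lemma ray_pade_mem_groebner_fan:
  assumes i: "3 * i + 5 \<le> p"
  shows "ray (pade_weight p i) \<in> groebner_fan (curve_ideal p)"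
proof -
  let ?w = "pade_weight p i" and ?g = "curve_param p"
  let ?x = "xyz 1 0 i" and ?y = "xyz 0 1 (i + 2)" and ?z = "xyz 0 0 (p - 1 - i)"
  have weight: "weight ?w (xyz j k l) = - real ((p - 1 - 2 * i) * j + (p - 3 - 2 * i) * k + l)" for j k l
    by (simp add: pade_weight_def)
  have std_x: "standard_expo ?g ?w ?x"
    by (rule pade_standard[of _ _ "monom 1 i" 0 0])
       (use i in \<open>auto simp: weight eval_expo_xyz X_power degree_monom_eq
          simp del: power_Suc weight_xyz\<close>)
  have std_y: "standard_expo ?g ?w ?y"
    by (rule pade_standard[of _ _ 0 "monom 1 (i + 2)" 0])
       (use i in \<open>auto simp: weight eval_expo_xyz X_power degree_monom_eq
          simp del: power_Suc weight_xyz\<close>)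
  have std_z: "standard_expo ?g ?w ?z"
    by (rule pade_standard[of _ _ 0 0 "monom 1 (p - 1 - i)"])
       (use i in \<open>auto simp: weight eval_expo_xyz X_power degree_monom_eq
          simp del: power_Suc weight_xyz\<close>)
  \<comment> \<open>No monomial has positive weight, so the zero subspace suffices for the constant
    term, which is \<open>u0\<close> below.\<close>
  have "standard_expo ?g ?w (xyz 0 0 0)"
    unfolding standard_expo_def
  proof (intro exI[of _ "{0}"] conjI allI impI)
    show "eval_expo ?g v \<in> {0}" if "weight ?w (xyz 0 0 0) < weight ?w v" for v
    proof -
      obtain j k l where v: "v = xyz j k l" by (rule xyz_cases)
      have False using that unfolding v weight by linarith
      then show ?thesis ..
    qed
  qed (auto simp: poly_subspace_def xyz_0)
  note std = std_x std_y std_z this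
  have "i < p" using i by simp
  then obtain A B C :: "complex poly" where rel: "A * [:1, 1:] ^ (p + 2) + B * [:- 1, 1:] ^ p + C = 0"
    and deg: "degree A = i" "degree B = i + 2" "degree C = p - 1 - i" and nz: "A \<noteq> 0" "B \<noteq> 0" "C \<noteq> 0"
    by (rule pade_exists)
  let ?f = "linear_xy A B C"
  have f: "?f \<in> curve_ideal p" using rel by (rule linear_xy_mem_curve_ideal)
  have lc: "coeff A i \<noteq> 0" "coeff B (i + 2) \<noteq> 0" "coeff C (p - 1 - i) \<noteq> 0"
    using deg nz by (metis leading_coeff_0_iff)+
  have wx: "weight ?w ?x = - real (p - 1 - i)" "weight ?w ?y = - real (p - 1 - i)"
    "weight ?w ?z = - real (p - 1 - i)"
    using i by (auto simp: weight simp del: weight_xyz)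
  have in_keys: "?x \<in> keys ?f" "?y \<in> keys ?f" "?z \<in> keys ?f"
    using lc by (auto simp: keys_linear_xy)
  \<comment> \<open>The variable z has negative weight, so in each of the three parts of
    \<open>?f\<close> only the top power of z attains the minimum.\<close>
  have bound: "v \<in> {?x, ?y, ?z} \<or> - real (p - 1 - i) < weight ?w v" if "v \<in> keys ?f" for v
  proof -
    have "l \<le> i" if "coeff A l \<noteq> 0" for l using that deg le_degree by metis
    moreover have "l \<le> i + 2" if "coeff B l \<noteq> 0" for l using that deg le_degree by metis
    moreover have "l \<le> p - 1 - i" if "coeff C l \<noteq> 0" for l using that deg le_degree by metis
    ultimately show ?thesis
      using that i unfolding keys_linear_xy by (fastforce simp: weight simp del: weight_xyz)
  qed
  have keys: "keys (initial_form ?w ?f) = {?x, ?y, ?z}"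
  proof -
    have min: "- real (p - 1 - i) \<le> weight ?w v" if "v \<in> keys ?f" for v
      using bound[OF that] wx by (auto simp del: weight_xyz)
    then show ?thesis
      using bound in_keys wx unfolding keys_initial_form
      by (auto simp del: weight_xyz) (metis not_le)+
  qed
  show ?thesis
  proof (rule ray_mem_groebner_fan_standard[where g = ?g and h = "generator_x p" and ?u0.0 = "xyz 0 0 0"])
    show "weight ?w v < weight ?w (xyz 0 0 0)" if "v \<in> keys (generator_x p)" "v \<noteq> xyz 0 0 0" for v
      using that i by (auto simp: keys_generator_x pade_weight_def)
    fix w'
    assume *: "\<And>f u. f \<in> curve_ideal p \<Longrightarrow> u \<in> keys (initial_form ?w f) \<Longrightarrow>
      standard_expo ?g ?w u \<Longrightarrow> \<exists>v\<in>keys (initial_form ?w f). v \<noteq> u \<and> weight w' v = weight w' u"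
    \<comment> \<open>Each of the three weights equals one of the other two, so all three
      coincide.\<close>
    have "weight w' ?x = weight w' ?y \<and> weight w' ?x = weight w' ?z"
      using *[OF f, of ?x] *[OF f, of ?y] *[OF f, of ?z] std unfolding keys
      by (simp del: weight_xyz) metis
    then have "w' $ 1 = w' $ 3 * (real (p - 1 - i) - real i)"
      "w' $ 2 = w' $ 3 * (real (p - 1 - i) - real (i + 2))"
      by (simp_all add: algebra_simps)
    moreover have "real (p - 1 - i) - real i = real (p - 1 - 2 * i)"
      "real (p - 1 - i) - real (i + 2) = real (p - 3 - 2 * i)"
      using i by linarith+
    ultimately have "w' = (- w' $ 3) *\<^sub>R ?w"
      by (simp add: vec3_eq_iff pade_weight_def algebra_simps)
    then show "\<exists>s. w' = s *\<^sub>R ?w" ..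
  qed (use std in \<open>auto simp: keys_generator_x generator_x_mem eval_curve_ideal\<close>)
qed

text \<open>Fixing a nonzero third coordinate singles out one generator of a ray, so distinct
  weights give distinct rays.\<close>

lemma ray_eq_imp_eq:
  assumes "ray v = ray w" "v $ 3 = - 1" "w $ 3 = - 1"
  shows "v = (w :: real ^ 3)"
  using ray_eqD[OF assms(1)] assms(2,3) by (auto simp: vec3_eq_iff)

text \<open>The lower bound is expressed by a finite set of rays of the fan, since
  \<open>card\<close> is 0 on infinite sets.\<close>

theorem theorem6p3:
  fixes p :: nat
  assumes "p \<ge> 1"
  shows "(\<exists>T. card T = 4 \<and> (\<forall>R\<in>T. is_ray R) \<and> tropical_variety (curve_ideal p) = \<Union>T) \<and>
    (\<exists>S \<subseteq> {R \<in> groebner_fan (curve_ideal p). is_ray R}.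
       finite S \<and> real (card S) \<ge> 1 / 4 * (real p + 1))"
proof
  define E :: "(real ^ 3) list" where
    "E = [vector [1, 0, 0], vector [0, 1, 0], vector [0, 0, 1], ray_at_infinity p]"
  have "distinct (map ray E)"
    by (auto simp: E_def vec3_eq_iff ray_at_infinity_def dest!: ray_eqD)
  then have "card (ray ` set E) = 4"
    using distinct_card[of "map ray E"] by (simp add: E_def)
  moreover have "\<forall>R\<in>ray ` set E. is_ray R"
    by (auto simp: E_def vec3_eq_iff ray_at_infinity_def intro!: is_ray_ray)
  moreover have "tropical_variety (curve_ideal p) = \<Union>(ray ` set E)"
    by (simp add: tropical_variety_curve_ideal[OF assms] E_def Un_assoc)
  ultimately show "\<exists>T. card T = 4 \<and> (\<forall>R\<in>T. is_ray R) \<and> tropical_variety (curve_ideal p) = \<Union>T"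
    by blast
next
  \<comment> \<open>These are exactly the \<open>i\<close> with 3i + 5 <= p; the set is empty for p
    < 5.\<close>
  define N where "N = {..<(p - 2) div 3}"
  define L where "L = insert (ray_at_infinity p) (pade_weight p ` N)"
  define S where "S = insert (ray (vector [0, 0, 1])) (ray ` L)"
  have N: "3 * i + 5 \<le> p" if "i \<in> N" for i
    using that unfolding N_def by simp
  have L3: "v $ 3 = - 1" if "v \<in> L" for v
    using that by (auto simp: L_def ray_at_infinity_def pade_weight_def)
  have "inj_on (pade_weight p) N"
  proof (rule inj_onI)
    fix i j assume ij: "i \<in> N" "j \<in> N" "pade_weight p i = pade_weight p j"
    then have "p - 1 - 2 * i = p - 1 - 2 * j" by (simp add: pade_weight_def vec3_eq_iff)
    then show "i = j" using N[OF ij(1)] N[OF ij(2)] by linarith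
  qed
  moreover have "ray_at_infinity p \<notin> pade_weight p ` N"
    by (auto simp: ray_at_infinity_def pade_weight_def vec3_eq_iff simp flip: of_nat_add)
  moreover have "finite N" by (simp add: N_def)
  ultimately have "card L = Suc (card N)" "finite L"
    by (simp_all add: L_def card_image)
  moreover have "inj_on ray L"
    using ray_eq_imp_eq L3 by (intro inj_onI) blast
  moreover have "ray (vector [0, 0, 1]) \<notin> ray ` L"
  proof
    assume "ray (vector [0, 0, 1]) \<in> ray ` L"
    then obtain v where v: "v \<in> L" "ray v = ray (vector [0, 0, 1])" by auto
    then show False using ray_eqD[OF v(2)] L3[OF v(1)] by auto
  qed
  ultimately have "finite S" and card: "card S = (p - 2) div 3 + 2"
    by (simp_all add: S_def card_image N_def)
  \<comment> \<open>The summand 2 counts the ray of the z-axis and the ray at infinity. It makes up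
    for the rounding and for the small \<open>p\<close> without Pade rays.\<close>
  have "4 * ((p - 2) div 3 + 2) \<ge> p + 1" by presburger
  then have "real (p + 1) \<le> real (4 * card S)"
    unfolding card of_nat_le_iff .
  then have "1 / 4 * (real p + 1) \<le> real (card S)" by simp
  moreover have "R \<in> groebner_fan (curve_ideal p) \<and> is_ray R" if "R \<in> S" for R
  proof -
    have "R = ray (vector [0, 0, 1]) \<or> R = ray (ray_at_infinity p) \<or> (\<exists>i\<in>N. R = ray (pade_weight p i))"
      using that by (auto simp: S_def L_def)
    moreover have "vector [0, 0, 1] \<noteq> (0 :: real ^ 3)" "ray_at_infinity p \<noteq> 0" "pade_weight p i \<noteq> 0" for i
      by (simp_all add: vec3_eq_iff ray_at_infinity_def pade_weight_def)
    ultimately show ?thesis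
      using ray_z_mem_groebner_fan ray_at_infinity_mem_groebner_fan ray_pade_mem_groebner_fan N
      by (metis is_ray_ray)
  qed
  ultimately show "\<exists>S \<subseteq> {R \<in> groebner_fan (curve_ideal p). is_ray R}.
      finite S \<and> 1 / 4 * (real p + 1) \<le> real (card S)"
    using \<open>finite S\<close> by (intro exI[of _ S]) auto
qed

end
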